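(* The refined decoupling algorithm is tightly $2$-approximate for the container delivery scheduling problem: on every instance it returns a feasible solution with $m\le 2\hat m$ bins, where $\hat m$ is the minimum number of bins of a feasible solution, and the factor $2$ cannot be replaced by any smaller constant.
   Context: An instance $\langle \mathcal{I},B\rangle$ of the container delivery scheduling problem consists of a set $\mathcal{I}=\{1,\ldots,n\}$ of items, each item $i$ having a due time $d_i\in\mathbb{Z}^+$, and an inventory bound $B>0$. For a time $\tau\ge 0$ put $\delta_i(\tau)=|d_i-\tau|$. A feasible solution with $m$ bins is a partition of $\mathcal{I}$ into subsets (bins) $\mathcal{S}_1,\ldots,\mathcal{S}_m$ together with delivery times $\mu_1,\ldots,\mu_m\ge 0$ such that $\sum_{i\in\mathcal{S}_j}\delta_i(\mu_j)\le B$ for every $j$. Several bins may be delivered at the same time. For a finite set $\mathcal{V}$ of times, $\delta_i(\mathcal{V})=\min_{\tau\in\mathcal{V}}|d_i-\tau|$. The subproblem $\mathrm{ET}(\mathcal{I},B,k)$ asks for a set $\mathcal{V}$ of $k$ times that minimizes $\sum_{i\in\mathcal{I}}\delta_i(\mathcal{V})$ subject to $\delta_i(\mathcal{V})\le B$ for every $i\in\mathcal{I}$. Decoupling step for a given $k$ (for which $\mathrm{ET}(\mathcal{I},B,k)$ is feasible): compute an optimal solution $\mathcal{V}=\{\tau_1<\ldots<\tau_k\}$ of $\mathrm{ET}(\mathcal{I},B,k)$; assign every item $i$ to one time of $\mathcal{V}$ closest to $d_i$ (ties broken arbitrarily), and let $\mathcal{I}_t$ be the set of items assigned to $\tau_t$;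 for each $t$ pack the items of $\mathcal{I}_t$, with sizes $\delta_i(\tau_t)$, into bins of capacity $B$ by a standard bin packing algorithm (First-Fit or First-Fit Decreasing), all delivered at $\tau_t$. Refinement step: for each $t$ for which the decoupling step uses at least two bins at $\tau_t$, discard these bins and repack $\mathcal{I}_t$ as follows. Let $\mathcal{A}_t=\{i\in\mathcal{I}_t:d_i\le\tau_t\}$ and $\mathcal{B}_t=\{i\in\mathcal{I}_t:d_i>\tau_t\}$. List $\mathcal{A}_t$ in non-decreasing order of due times as $\pi(1),\pi(2),\ldots$. Starting with $h=1$, as long as the items $\pi(h),\pi(h+1),\ldots$ of $\mathcal{A}_t$ satisfy that the sum of their $\delta(\tau_t)$-values exceeds $B$, find the minimum index $i\ge h$ with $\sum_{g=h}^{i}\delta_{\pi(g)}(\tau_t)>B$, schedule one bin delivery at time $d_{\pi(i)}$ containing exactly $\pi(h),\ldots,\pi(i)$, and set $h=i+1$. Let $\widetilde{\mathcal{A}}_t$ be the remaining items of $\mathcal{A}_t$. Perform the same process for $\mathcal{B}_t$, with its items listed in non-increasing order of due times (the mirror image of the process for $\mathcal{A}_t$), and let $\widetilde{\mathcal{B}}_t$ be the remaining items. If $\sum_{i\in\widetilde{\mathcal{A}}_t\cup\widetilde{\mathcal{B}}_t}\delta_i(\tau_t)\le B$, deliver $\widetilde{\mathcal{A}}_t\cup\widetilde{\mathcal{B}}_t$ in a single bin at $\tau_t$; otherwise deliver $\widetilde{\mathcal{A}}_t$ and $\widetilde{\mathcal{B}}_t$ in two separate bins at $\tau_t$. Refined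 decoupling algorithm: for each $k\in\{1,\ldots,n\}$ for which $\mathrm{ET}(\mathcal{I},B,k)$ is feasible, perform the decoupling step followed by the refinement step; return a solution with the fewest bins over all such $k$. *)

theory Defs
  imports Complex_Main "HOL-Library.Disjoint_Sets"
begin

definition delivery_instance :: "nat \<Rightarrow> (nat \<Rightarrow> nat) \<Rightarrow> real \<Rightarrow> bool" where
  "delivery_instance n d B \<longleftrightarrow> 1 \<le> n \<and> (\<forall>i\<in>{1..n}. 0 < d i) \<and> 0 < B"

definition delta :: "(nat \<Rightarrow> nat) \<Rightarrow> nat \<Rightarrow> real \<Rightarrow> real" where
  "delta d i \<tau> = \<bar>real (d i) - \<tau>\<bar>"


text \<open>A solution is the list of its bins, each given by its items and its delivery time.
  The number of bins is the length of the list.\<close>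

type_synonym solution = "(nat set \<times> real) list"

definition feasible_solution :: "nat \<Rightarrow> (nat \<Rightarrow> nat) \<Rightarrow> real \<Rightarrow> solution \<Rightarrow> bool" where
  "feasible_solution n d B sol \<longleftrightarrow>
     distinct (map fst sol) \<and> partition_on {1..n} (set (map fst sol)) \<and>
     (\<forall>(S, \<mu>)\<in>set sol. 0 \<le> \<mu> \<and> (\<Sum>i\<in>S. delta d i \<mu>) \<le> B)"

definition min_bins :: "nat \<Rightarrow> (nat \<Rightarrow> nat) \<Rightarrow> real \<Rightarrow> nat" where
  "min_bins n d B = (LEAST m. \<exists>sol. feasible_solution n d B sol \<and> length sol = m)"


definition delta_set :: "(nat \<Rightarrow> nat) \<Rightarrow> nat \<Rightarrow> real set \<Rightarrow> real" where
  "delta_set d i V = Min ((\<lambda>\<tau>. delta d i \<tau>) ` V)"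

definition ET_feasible :: "nat \<Rightarrow> (nat \<Rightarrow> nat) \<Rightarrow> real \<Rightarrow> nat \<Rightarrow> real set \<Rightarrow> bool" where
  "ET_feasible n d B k V \<longleftrightarrow>
     finite V \<and> card V = k \<and> (\<forall>\<tau>\<in>V. 0 \<le> \<tau>) \<and> (\<forall>i\<in>{1..n}. delta_set d i V \<le> B)"

definition ET_optimal :: "nat \<Rightarrow> (nat \<Rightarrow> nat) \<Rightarrow> real \<Rightarrow> nat \<Rightarrow> real set \<Rightarrow> bool" where
  "ET_optimal n d B k = is_arg_min (\<lambda>V. \<Sum>i\<in>{1..n}. delta_set d i V) (ET_feasible n d B k)"


datatype packing_rule = First_Fit | First_Fit_Decreasing

fun first_fit_insert :: "(nat \<Rightarrow> real) \<Rightarrow> real \<Rightarrow> nat \<Rightarrow> nat list list \<Rightarrow> nat list list" where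
  "first_fit_insert w B x [] = [[x]]"
| "first_fit_insert w B x (b # bs) =
     (if (\<Sum>y\<leftarrow>b. w y) + w x \<le> B then (b @ [x]) # bs else b # first_fit_insert w B x bs)"

definition first_fit :: "(nat \<Rightarrow> real) \<Rightarrow> real \<Rightarrow> nat list \<Rightarrow> nat list list" where
  "first_fit w B xs = fold (first_fit_insert w B) xs []"

text \<open>First-Fit may process the items in any order, First-Fit Decreasing processes them by
  non-increasing size.\<close>

fun packing_order :: "packing_rule \<Rightarrow> (nat \<Rightarrow> real) \<Rightarrow> nat list \<Rightarrow> bool" where
  "packing_order First_Fit w xs \<longleftrightarrow> True"
| "packing_order First_Fit_Decreasing w xs \<longleftrightarrow> sorted_wrt (\<lambda>x y. w x \<ge> w y) xs"


text \<open>\<open>peel w B xs bs rest\<close>: starting from the list \<open>xs\<close>, the repeated removal of the shortest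
  prefix of total size exceeding \<open>B\<close> yields the bins \<open>bs\<close> and leaves \<open>rest\<close>.\<close>

inductive peel :: "(nat \<Rightarrow> real) \<Rightarrow> real \<Rightarrow> nat list \<Rightarrow> nat list list \<Rightarrow> nat list \<Rightarrow> bool"
  for w :: "nat \<Rightarrow> real" and B :: real where
  stop: "(\<Sum>x\<leftarrow>xs. w x) \<le> B \<Longrightarrow> peel w B xs [] xs"
| step: "\<lbrakk>(\<Sum>x\<leftarrow>xs. w x) > B; i = (LEAST i. (\<Sum>x\<leftarrow>take i xs. w x) > B);
          peel w B (drop i xs) bs rest\<rbrakk>
         \<Longrightarrow> peel w B xs (take i xs # bs) rest"

text \<open>The two remainders share a bin at \<open>\<tau>\<close> if they fit together. No bin is delivered
  if nothing remains. In the last case both remainders are nonempty.\<close>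

definition remainder_bins :: "(nat \<Rightarrow> nat) \<Rightarrow> real \<Rightarrow> real \<Rightarrow> nat set \<Rightarrow> nat set \<Rightarrow> solution" where
  "remainder_bins d B \<tau> A' B' =
     (if A' \<union> B' = {} then []
      else if (\<Sum>i\<in>A' \<union> B'. delta d i \<tau>) \<le> B then [(A' \<union> B', \<tau>)]
      else [(A', \<tau>), (B', \<tau>)])"

definition refined_bins :: "(nat \<Rightarrow> nat) \<Rightarrow> real \<Rightarrow> real \<Rightarrow> nat set \<Rightarrow> solution \<Rightarrow> bool" where
  "refined_bins d B \<tau> I bins \<longleftrightarrow>
     (\<exists>xs ys as bs ra rb.
        distinct xs \<and> set xs = {i\<in>I. real (d i) \<le> \<tau>} \<and> sorted_wrt (\<lambda>i j. d i \<le> d j) xs \<and>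
        distinct ys \<and> set ys = {i\<in>I. real (d i) > \<tau>} \<and> sorted_wrt (\<lambda>i j. d i \<ge> d j) ys \<and>
        peel (\<lambda>i. delta d i \<tau>) B xs as ra \<and>
        peel (\<lambda>i. delta d i \<tau>) B ys bs rb \<and>
        bins = map (\<lambda>b. (set b, real (d (last b)))) (as @ bs) @
               remainder_bins d B \<tau> (set ra) (set rb))"

text \<open>The bins finally used for the items \<open>I\<close> assigned to the time \<open>\<tau>\<close>.\<close>

definition bins_at :: "packing_rule \<Rightarrow> (nat \<Rightarrow> nat) \<Rightarrow> real \<Rightarrow> real \<Rightarrow> nat set \<Rightarrow> solution \<Rightarrow> bool" where
  "bins_at rule d B \<tau> I bins \<longleftrightarrow>
     (\<exists>xs. distinct xs \<and> set xs = I \<and> packing_order rule (\<lambda>i. delta d i \<tau>) xs \<and>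
        (let P = first_fit (\<lambda>i. delta d i \<tau>) B xs in
         if length P \<ge> 2 then refined_bins d B \<tau> I bins
         else bins = map (\<lambda>b. (set b, \<tau>)) P))"


text \<open>The steps of the algorithm leave choices open (the optimal set of times, ties), so the
  algorithm is a relation between instances and the solutions it can return.\<close>

definition decouple_and_refine ::
    "packing_rule \<Rightarrow> nat \<Rightarrow> (nat \<Rightarrow> nat) \<Rightarrow> real \<Rightarrow> nat \<Rightarrow> solution \<Rightarrow> bool" where
  "decouple_and_refine rule n d B k sol \<longleftrightarrow>
     (\<exists>V a bins.
        ET_optimal n d B k V \<and>
        (\<forall>i\<in>{1..n}. a i \<in> V \<and> delta d i (a i) = delta_set d i V) \<and>
        (\<forall>\<tau>\<in>V. bins_at rule d B \<tau> {i\<in>{1..n}. a i = \<tau>} (bins \<tau>)) \<and>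
        sol = concat (map bins (sorted_list_of_set V)))"

definition refined_decoupling ::
    "packing_rule \<Rightarrow> nat \<Rightarrow> (nat \<Rightarrow> nat) \<Rightarrow> real \<Rightarrow> solution \<Rightarrow> bool" where
  "refined_decoupling rule n d B sol \<longleftrightarrow>
     (\<exists>run k. let K = {k\<in>{1..n}. \<exists>V. ET_feasible n d B k V} in
        (\<forall>k\<in>K. decouple_and_refine rule n d B k (run k)) \<and>
        is_arg_min (\<lambda>k. length (run k)) (\<lambda>k. k \<in> K) k \<and>
        sol = run k)"

end

theory Submission
  imports Defs "HOL-Library.Multiset"
begin

text \<open>Upper bound: repacking a time with total assigned size \<open>s\<close> uses at most \<open>1 + s / B\<close> bins.
  If an optimal solution uses \<open>k\<close> distinct times, these times are admissible for the subproblem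
  with \<open>k\<close> times and have cost at most \<open>B\<close> per optimal bin. So the run for this \<open>k\<close> uses at most
  \<open>k\<close> bins plus the optimal number.

  Lower bound: put items at \<open>1, R, R\<^sup>2, \<dots>, R\<^bsup>2b-1\<^esup>\<close> for a huge \<open>R\<close>, with multiplicities such that
  serving all items at one position from any earlier time costs slightly less than \<open>B\<close>, and
  decreasingly so along the positions. Serving consecutive positions in pairs takes \<open>b\<close> bins. An
  optimal set of \<open>k\<close> times however sits at the first \<open>k\<close> positions, and the last of these times
  has to serve all the remaining \<open>2b - k\<close> positions, at a cost of about \<open>B\<close> each.\<close>

section \<open>Feasible packings of a set of items\<close>

text \<open>The additive one in \<open>1 + s / B\<close> comes from the remainders. Every peeled bin
  carries more than \<open>B\<close>, and the remainders of the two sides of a time take a second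
  bin only if they jointly exceed \<open>B\<close>. A peeled bin is overfull at
  \<open>\<tau>\<close> only because of its last item, and delivering at the due time of that item
  makes it free. Since the existence of a run is part of the claim, the minimum of the subproblem
  must be shown to be attained although times are real numbers. Sets of exactly \<open>k\<close>
  distinct times are not closed under limits, so slots are allowed to share a time, and missing
  times are added afterwards. In the lower bound position \<open>j\<close> has total weight
  \<open>(q - j) * W\<close>, where \<open>W\<close> is the last position and
  \<open>C = q * W\<close> the inventory bound. The drop by one \<open>W\<close> per position
  singles out the first \<open>k\<close> positions, and all errors have to stay below this
  gap.\<close>

definition feasible_on :: "nat set \<Rightarrow> (nat \<Rightarrow> nat) \<Rightarrow> real \<Rightarrow> solution \<Rightarrow> bool" where
  "feasible_on I d B sol \<longleftrightarrow>
     distinct (map fst sol) \<and> partition_on I (set (map fst sol)) \<and>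
     (\<forall>(S, \<mu>)\<in>set sol. 0 \<le> \<mu> \<and> (\<Sum>i\<in>S. delta d i \<mu>) \<le> B)"

lemma delta_nonneg: "0 \<le> delta d i \<tau>"
  by (simp add: delta_def)

lemma feasible_solution_iff: "feasible_solution n d B sol \<longleftrightarrow> feasible_on {1..n} d B sol"
  by (simp add: feasible_solution_def feasible_on_def)

lemma feasible_on_Nil: "feasible_on {} d B []"
  by (simp add: feasible_on_def partition_on_def)

lemma feasible_on_single:
  "\<lbrakk>S \<noteq> {}; 0 \<le> \<mu>; (\<Sum>i\<in>S. delta d i \<mu>) \<le> B\<rbrakk> \<Longrightarrow> feasible_on S d B [(S, \<mu>)]"
  by (simp add: feasible_on_def partition_on_def)

text \<open>A bin occurring in both lists would lie in \<open>I \<inter> J\<close> and hence be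
  empty, which \<open>partition_on\<close> forbids. So disjoint item sets also keep the bins
  distinct.\<close>

lemma feasible_on_append:
  assumes "feasible_on I d B s" "feasible_on J d B t" "I \<inter> J = {}"
  shows "feasible_on (I \<union> J) d B (s @ t)"
proof -
  have ps: "partition_on I (fst ` set s)" and pt: "partition_on J (fst ` set t)"
    using assms by (auto simp: feasible_on_def)
  have IJ: "\<Union> (fst ` set s) = I" "\<Union> (fst ` set t) = J"
    using ps pt by (simp_all add: partition_on_def)
  have "fst ` set s \<inter> fst ` set t = {}"
  proof (rule ccontr)
    assume "fst ` set s \<inter> fst ` set t \<noteq> {}"
    then obtain S where S: "S \<in> fst ` set s" "S \<in> fst ` set t" by blast
    then have "S \<subseteq> I \<inter> J" using IJ by blast
    then have "S = {}" using assms(3) by simp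
    then show False using S ps by (auto simp: partition_on_def)
  qed
  moreover have "disjoint (fst ` set s \<union> fst ` set t)"
    using ps pt assms(3) IJ by (intro disjoint_union) (auto simp: partition_on_def)
  ultimately show ?thesis
    using assms ps pt IJ by (auto simp: feasible_on_def partition_on_def)
qed

lemma feasible_on_concat:
  assumes "\<And>x. x \<in> set xs \<Longrightarrow> feasible_on (I x) d B (f x)" "distinct xs"
    and "\<And>x y. \<lbrakk>x \<in> set xs; y \<in> set xs; x \<noteq> y\<rbrakk> \<Longrightarrow> I x \<inter> I y = {}"
  shows "feasible_on (\<Union>x\<in>set xs. I x) d B (concat (map f xs))"
  using assms
proof (induction xs)
  case Nil
  then show ?case by (simp add: feasible_on_Nil)
next
  case (Cons x xs)
  have "feasible_on (I x \<union> (\<Union>y\<in>set xs. I y)) d B (f x @ concat (map f xs))"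
  proof (rule feasible_on_append)
    show "feasible_on (\<Union>y\<in>set xs. I y) d B (concat (map f xs))"
      using Cons.prems by (intro Cons.IH) auto
    show "I x \<inter> (\<Union>y\<in>set xs. I y) = {}"
      using Cons.prems(2) Cons.prems(3)[of x] by fastforce
  qed (use Cons.prems in auto)
  then show ?case by simp
qed

lemma feasible_on_lists:
  assumes "distinct (concat bs)" "[] \<notin> set bs"
    and "\<And>b. b \<in> set bs \<Longrightarrow> 0 \<le> f b \<and> (\<Sum>i\<leftarrow>b. delta d i (f b)) \<le> B"
  shows "feasible_on (set (concat bs)) d B (map (\<lambda>b. (set b, f b)) bs)"
  using assms
proof (induction bs)
  case Nil
  then show ?case by (simp add: feasible_on_Nil)
next
  case (Cons b bs)
  have "(\<Sum>i\<in>set b. delta d i (f b)) \<le> B"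
    using Cons.prems(1) Cons.prems(3)[of b]
    by (simp add: sum_list_distinct_conv_sum_set del: distinct_concat_iff)
  then have "feasible_on (set b) d B [(set b, f b)]"
    using Cons.prems(2,3) by (intro feasible_on_single) auto
  moreover have "feasible_on (set (concat bs)) d B (map (\<lambda>b. (set b, f b)) bs)"
    using Cons.prems by (intro Cons.IH) auto
  ultimately show ?case
    using Cons.prems(1) feasible_on_append[of "set b" d B "[(set b, f b)]" "set (concat bs)"]
    by auto
qed

section \<open>First-Fit and peeling\<close>

lemma first_fit_insert_mset:
  "mset (concat (first_fit_insert w B x bs)) = add_mset x (mset (concat bs))"
  by (induction bs) auto

lemma first_fit_insert_bins:
  assumes "\<forall>b\<in>set bs. b \<noteq> [] \<and> sum_list (map w b) \<le> B" "w x \<le> B"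
  shows "\<forall>b\<in>set (first_fit_insert w B x bs). b \<noteq> [] \<and> sum_list (map w b) \<le> B"
  using assms(1)
proof (induction bs)
  case (Cons b bs)
  then show ?case using assms(2) by simp
qed (use assms(2) in simp)

lemma fold_first_fit_insert:
  assumes "\<forall>b\<in>set bs. b \<noteq> [] \<and> sum_list (map w b) \<le> B" "\<forall>x\<in>set xs. w x \<le> B"
  shows "mset (concat (fold (first_fit_insert w B) xs bs)) = mset xs + mset (concat bs) \<and>
    (\<forall>b\<in>set (fold (first_fit_insert w B) xs bs). b \<noteq> [] \<and> sum_list (map w b) \<le> B)"
  using assms
proof (induction xs arbitrary: bs)
  case (Cons x xs)
  have "\<forall>b\<in>set (first_fit_insert w B x bs). b \<noteq> [] \<and> sum_list (map w b) \<le> B"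
    using Cons.prems by (intro first_fit_insert_bins) simp_all
  from Cons.IH[OF this] Cons.prems(2) show ?case
    by (simp add: first_fit_insert_mset)
qed simp

text \<open>A new bin is opened without a capacity test, so each single item has to fit. In the
  algorithm this is the constraint \<open>delta_set d i V \<le> B\<close> of the subproblem.\<close>

lemma first_fit_correct:
  assumes "\<forall>x\<in>set xs. w x \<le> B"
  shows "mset (concat (first_fit w B xs)) = mset xs"
    and "b \<in> set (first_fit w B xs) \<Longrightarrow> b \<noteq> []"
    and "b \<in> set (first_fit w B xs) \<Longrightarrow> sum_list (map w b) \<le> B"
  using fold_first_fit_insert[of "[]" w B xs, OF _ assms] unfolding first_fit_def by simp_all

lemma peel_concat: "peel w B xs bs rest \<Longrightarrow> xs = concat bs @ rest"
proof (induction rule: peel.induct)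
  case (step xs i bs rest)
  have "take i xs @ concat bs @ rest = xs"
    using step.IH append_take_drop_id[of i xs] by metis
  then show ?case by simp
qed simp

lemma peel_rest: "peel w B xs bs rest \<Longrightarrow> sum_list (map w rest) \<le> B"
  by (induction rule: peel.induct) auto

text \<open>\<open>0 < B\<close> excludes the empty prefix, so there is a last item; minimality of
  \<open>i\<close> bounds everything before it by \<open>B\<close>.\<close>

lemma shortest_excess_prefix:
  fixes w :: "nat \<Rightarrow> real"
  assumes "sum_list (map w xs) > B" "0 < B"
    and i: "i = (LEAST i. sum_list (map w (take i xs)) > B)"
  shows "0 < i" "i \<le> length xs" "sum_list (map w (take i xs)) > B"
    "sum_list (map w (butlast (take i xs))) \<le> B"
proof -
  have ex: "sum_list (map w (take (length xs) xs)) > B" using assms by simp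
  show gt: "sum_list (map w (take i xs)) > B"
    unfolding i by (rule LeastI, rule ex)
  show le: "i \<le> length xs"
    unfolding i by (rule Least_le, rule ex)
  show pos: "0 < i"
    using gt assms(2) by (cases i) auto
  have "\<not> sum_list (map w (take (i - 1) xs)) > B"
    by (rule not_less_Least) (use i pos in simp)
  then show "sum_list (map w (butlast (take i xs))) \<le> B"
    using le by (simp add: butlast_take)
qed

text \<open>The lower estimate charges each bin to the total size; the estimate for
  \<open>butlast b\<close> makes the bin affordable at the due time of its last item.\<close>

lemma peel_bins:
  assumes "peel w B xs bs rest" "0 < B" "b \<in> set bs"
  shows "b \<noteq> [] \<and> sum_list (map w b) > B \<and> sum_list (map w (butlast b)) \<le> B"
  using assms
proof (induction rule: peel.induct)
  case (step xs i bs rest)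
  note i = shortest_excess_prefix[OF step.hyps(1) \<open>0 < B\<close> step.hyps(2)]
  have "take i xs \<noteq> []" using i(1,2) by auto
  then show ?case using step i by auto
qed simp

lemma peel_exists:
  assumes "0 < B"
  shows "\<exists>bs rest. peel w B xs bs rest"
proof (induction "length xs" arbitrary: xs rule: less_induct)
  case less
  show ?case
  proof (cases "sum_list (map w xs) \<le> B")
    case True
    then show ?thesis using peel.stop by blast
  next
    case False
    define i where "i = (LEAST i. sum_list (map w (take i xs)) > B)"
    have "0 < i" "i \<le> length xs"
      using shortest_excess_prefix[of B w xs i] False assms i_def by auto
    then have "length (drop i xs) < length xs" by simp
    then obtain bs rest where "peel w B (drop i xs) bs rest" using less by blast
    then have "peel w B xs (take i xs # bs) rest"
      using False i_def by (intro peel.step) auto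
    then show ?thesis by blast
  qed
qed

lemma sum_list_concat_ge:
  fixes w :: "nat \<Rightarrow> real" and c :: real
  assumes "\<And>b. b \<in> set bs \<Longrightarrow> c \<le> sum_list (map w b)"
  shows "real (length bs) * c \<le> sum_list (map w (concat bs))"
  using assms
proof (induction bs)
  case (Cons b bs)
  then have "c \<le> sum_list (map w b)" "real (length bs) * c \<le> sum_list (map w (concat bs))" by auto
  then show ?case by (simp add: distrib_right)
qed simp

lemma sum_list_concat_le:
  fixes w :: "nat \<Rightarrow> real" and c :: real
  assumes "\<And>b. b \<in> set bs \<Longrightarrow> sum_list (map w b) \<le> c"
  shows "sum_list (map w (concat bs)) \<le> real (length bs) * c"
  using assms
proof (induction bs)
  case (Cons b bs)
  then have "sum_list (map w b) \<le> c" "sum_list (map w (concat bs)) \<le> real (length bs) * c" by auto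
  then show ?case by (simp add: distrib_right)
qed simp

lemma last_in_concat: "\<lbrakk>b \<in> set bs; b \<noteq> []\<rbrakk> \<Longrightarrow> last b \<in> set (concat bs)"
  using last_in_set[of b] by (simp only: set_concat) blast

text \<open>Each bin carries between \<open>B\<close> and \<open>B + \<sigma>\<close>, because it
  exceeds \<open>B\<close> only through its last item. The first inequality bounds the number of
  bins from above, the second from below.\<close>

lemma peel_weight:
  assumes "peel w B xs bs rest" "0 < B" "\<And>x. x \<in> set xs \<Longrightarrow> w x \<le> \<sigma>"
  shows "real (length bs) * B + sum_list (map w rest) \<le> sum_list (map w xs)"
    and "sum_list (map w xs) \<le> real (length bs) * (B + \<sigma>) + sum_list (map w rest)"
proof -
  note xs = peel_concat[OF assms(1)]
  have "real (length bs) * B \<le> sum_list (map w (concat bs))"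
    using peel_bins[OF assms(1,2)] by (intro sum_list_concat_ge) (simp add: less_imp_le)
  then show "real (length bs) * B + sum_list (map w rest) \<le> sum_list (map w xs)"
    by (simp add: xs)
  have "sum_list (map w (concat bs)) \<le> real (length bs) * (B + \<sigma>)"
  proof (rule sum_list_concat_le)
    fix b assume b: "b \<in> set bs"
    note p = peel_bins[OF assms(1,2) b]
    have "map w (butlast b @ [last b]) = map w b" using p by simp
    then have "map w b = map w (butlast b) @ [w (last b)]" by simp
    then have "sum_list (map w b) = sum_list (map w (butlast b)) + w (last b)" by simp
    moreover have "last b \<in> set xs" using last_in_concat[OF b] p unfolding xs by simp
    ultimately show "sum_list (map w b) \<le> B + \<sigma>" using p assms(3)[of "last b"] by linarith
  qed
  then show "sum_list (map w xs) \<le> real (length bs) * (B + \<sigma>) + sum_list (map w rest)"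
    by (simp add: xs)
qed

lemma sorted_wrt_concatD:
  "\<lbrakk>sorted_wrt P (concat bs); b \<in> set bs\<rbrakk> \<Longrightarrow> sorted_wrt P b"
  by (induction bs) (auto simp: sorted_wrt_append)

lemma sorted_wrt_lastD:
  assumes "sorted_wrt P b" "x \<in> set b" "\<And>x. P x x"
  shows "P x (last b)"
proof -
  have b: "butlast b @ [last b] = b" using append_butlast_last_id[of b] assms(2) by (cases "b = []") simp_all
  have "sorted_wrt P (butlast b @ [last b])" using assms(1) by (simp only: b)
  moreover have "x \<in> set (butlast b @ [last b])"
    using assms(2) by (simp only: b)
  then have "x \<in> set (butlast b) \<or> x = last b" by auto
  ultimately show ?thesis using assms(3) by (auto simp: sorted_wrt_append)
qed

text \<open>The last item of a peeled bin costs nothing at its own due time, and moving there from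
  \<open>\<tau>\<close> makes no other item of the bin more expensive.\<close>

lemma peeled_bin_cost:
  assumes "peel (\<lambda>i. delta d i \<tau>) B xs bs rest" "0 < B" "b \<in> set bs"
    and closer: "\<And>g. g \<in> set b \<Longrightarrow> delta d g (real (d (last b))) \<le> delta d g \<tau>"
  shows "(\<Sum>i\<leftarrow>b. delta d i (real (d (last b)))) \<le> B"
proof -
  note p = peel_bins[OF assms(1-3)]
  let ?l = "last b"
  have b: "b = butlast b @ [?l]" using p by simp
  define f where "f = (\<lambda>i. delta d i (real (d ?l)))"
  have "map f (butlast b @ [?l]) = map f b" using p by simp
  then have "map f b = map f (butlast b) @ [f ?l]" by simp
  then have "sum_list (map f b) = sum_list (map f (butlast b)) + f ?l" by simp
  then have "(\<Sum>i\<leftarrow>b. delta d i (real (d ?l))) =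
      (\<Sum>i\<leftarrow>butlast b. delta d i (real (d ?l))) + delta d ?l (real (d ?l))"
    by (simp add: f_def)
  also have "delta d ?l (real (d ?l)) = 0" by (simp add: delta_def)
  also have "(\<Sum>i\<leftarrow>butlast b. delta d i (real (d ?l))) \<le> (\<Sum>i\<leftarrow>butlast b. delta d i \<tau>)"
    by (intro sum_list_mono closer) (auto dest: in_set_butlastD)
  finally show ?thesis using p by simp
qed

section \<open>Bins used at a single time\<close>

lemma remainder_bins_feasible:
  assumes "finite A" "finite A'" "A \<inter> A' = {}" "0 \<le> \<tau>" "0 < B"
    and "(\<Sum>i\<in>A. delta d i \<tau>) \<le> B" "(\<Sum>i\<in>A'. delta d i \<tau>) \<le> B"
  shows "feasible_on (A \<union> A') d B (remainder_bins d B \<tau> A A')"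
proof -
  consider "A \<union> A' = {}" | "A \<union> A' \<noteq> {}" "(\<Sum>i\<in>A \<union> A'. delta d i \<tau>) \<le> B"
    | "A \<union> A' \<noteq> {}" "\<not> (\<Sum>i\<in>A \<union> A'. delta d i \<tau>) \<le> B" by blast
  then show ?thesis
  proof cases
    case 1
    then show ?thesis by (simp add: remainder_bins_def feasible_on_Nil)
  next
    case 2
    then have "remainder_bins d B \<tau> A A' = [(A \<union> A', \<tau>)]" by (simp add: remainder_bins_def)
    then show ?thesis using 2 assms(4) by (simp add: feasible_on_single)
  next
    case 3
    \<comment> \<open>If one remainder were empty, the union would be the other one, which fits into
      a single bin.\<close>
    then have "A \<noteq> {}" "A' \<noteq> {}" using assms by auto
    then have "feasible_on A d B [(A, \<tau>)]" "feasible_on A' d B [(A', \<tau>)]"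
      using assms by (auto intro: feasible_on_single)
    moreover have "remainder_bins d B \<tau> A A' = [(A, \<tau>)] @ [(A', \<tau>)]"
      using 3 by (simp add: remainder_bins_def)
    ultimately show ?thesis using feasible_on_append assms(3) by metis
  qed
qed

text \<open>Two bins occur only if the joint remainder exceeds \<open>B\<close>, so both sides of
  \<open>\<tau>\<close> together cost a single additive \<open>B\<close>. With one \<open>B\<close>
  per side the factor 2 would be lost.\<close>

lemma remainder_bins_length:
  assumes "finite A" "finite A'" "0 < B"
    and "(\<Sum>i\<in>A. delta d i \<tau>) \<le> B" "(\<Sum>i\<in>A'. delta d i \<tau>) \<le> B"
  shows "real (length (remainder_bins d B \<tau> A A')) * B \<le> B + (\<Sum>i\<in>A \<union> A'. delta d i \<tau>)"
    and "(\<Sum>i\<in>A \<union> A'. delta d i \<tau>) \<le> real (length (remainder_bins d B \<tau> A A')) * B"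
proof -
  have "0 \<le> (\<Sum>i\<in>A \<union> A'. delta d i \<tau>)" by (simp add: sum_nonneg delta_nonneg)
  then show "real (length (remainder_bins d B \<tau> A A')) * B \<le> B + (\<Sum>i\<in>A \<union> A'. delta d i \<tau>)"
    using assms(3) by (auto simp: remainder_bins_def)
  have "(\<Sum>i\<in>A \<union> A'. delta d i \<tau>) \<le> (\<Sum>i\<in>A. delta d i \<tau>) + (\<Sum>i\<in>A'. delta d i \<tau>)"
    using sum.union_inter[OF assms(1,2), of "\<lambda>i. delta d i \<tau>"]
      sum_nonneg[of "A \<inter> A'" "\<lambda>i. delta d i \<tau>"] by (simp add: delta_nonneg)
  then show "(\<Sum>i\<in>A \<union> A'. delta d i \<tau>) \<le> real (length (remainder_bins d B \<tau> A A')) * B"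
    using assms(4,5) by (auto simp: remainder_bins_def)
qed

text \<open>Each side is listed towards \<open>\<tau>\<close>, so the last item of a peeled bin is
  the one closest to \<open>\<tau>\<close>. Its due time lies between \<open>\<tau>\<close> and all
  other items of the bin, and moving the delivery there brings it closer to each of them.\<close>

lemma refined_bins_feasible:
  assumes "refined_bins d B \<tau> I bins" "0 < B" "0 \<le> \<tau>"
  shows "feasible_on I d B bins"
proof -
  obtain xs ys as bs ra rb where
    xs: "distinct xs" "set xs = {i\<in>I. real (d i) \<le> \<tau>}" "sorted_wrt (\<lambda>i j. d i \<le> d j) xs" and
    ys: "distinct ys" "set ys = {i\<in>I. real (d i) > \<tau>}" "sorted_wrt (\<lambda>i j. d i \<ge> d j) ys" and
    pa: "peel (\<lambda>i. delta d i \<tau>) B xs as ra" and pb: "peel (\<lambda>i. delta d i \<tau>) B ys bs rb" and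
    bins: "bins = map (\<lambda>b. (set b, real (d (last b)))) (as @ bs) @
               remainder_bins d B \<tau> (set ra) (set rb)"
    using assms(1) by (auto simp: refined_bins_def)
  note cx = peel_concat[OF pa] and cy = peel_concat[OF pb]
  have disj: "set xs \<inter> set ys = {}" and I: "I = set xs \<union> set ys" using xs(2) ys(2) by auto
  have cost: "(\<Sum>i\<leftarrow>b. delta d i (real (d (last b)))) \<le> B" if "b \<in> set (as @ bs)" for b
  proof (cases "b \<in> set as")
    case True
    then have "sorted_wrt (\<lambda>i j. d i \<le> d j) b"
      using xs(3) sorted_wrt_concatD[of _ as b] unfolding cx by (simp add: sorted_wrt_append)
    then have "d g \<le> d (last b)" if "g \<in> set b" for g
      using sorted_wrt_lastD[of "\<lambda>i j. d i \<le> d j" b g] that by simp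
    moreover have "last b \<in> set xs"
      using last_in_concat[OF True] peel_bins[OF pa assms(2) True] unfolding cx by simp
    ultimately show ?thesis
      using xs(2) by (intro peeled_bin_cost[OF pa assms(2) True]) (force simp: delta_def)
  next
    case False
    then have b: "b \<in> set bs" using that by simp
    then have "sorted_wrt (\<lambda>i j. d i \<ge> d j) b"
      using ys(3) sorted_wrt_concatD[of _ bs b] unfolding cy by (simp add: sorted_wrt_append)
    then have "d g \<ge> d (last b)" if "g \<in> set b" for g
      using sorted_wrt_lastD[of "\<lambda>i j. d i \<ge> d j" b g] that by simp
    moreover have "last b \<in> set ys"
      using last_in_concat[OF b] peel_bins[OF pb assms(2) b] unfolding cy by simp
    ultimately show ?thesis
      using ys(2) by (intro peeled_bin_cost[OF pb assms(2) b]) (force simp: delta_def)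
  qed
  have dist: "distinct (concat (as @ bs))"
    using xs(1) ys(1) disj unfolding cx cy by auto
  have "feasible_on (set (concat (as @ bs))) d B (map (\<lambda>b. (set b, real (d (last b)))) (as @ bs))"
    using dist cost peel_bins[OF pa assms(2)] peel_bins[OF pb assms(2)]
    by (intro feasible_on_lists) auto
  moreover have "feasible_on (set ra \<union> set rb) d B (remainder_bins d B \<tau> (set ra) (set rb))"
    using peel_rest[OF pa] peel_rest[OF pb] xs(1) ys(1) disj assms(2,3) unfolding cx cy
    by (intro remainder_bins_feasible) (auto simp: sum_list_distinct_conv_sum_set)
  moreover have "set (concat (as @ bs)) \<inter> (set ra \<union> set rb) = {}"
    using xs(1) ys(1) disj unfolding cx cy by auto
  moreover have "I = set (concat (as @ bs)) \<union> (set ra \<union> set rb)"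
    unfolding I cx cy by auto
  ultimately show ?thesis unfolding bins by (metis feasible_on_append)
qed

lemma refined_bins_length:
  assumes "refined_bins d B \<tau> I bins" "0 < B" "\<And>i. i \<in> I \<Longrightarrow> delta d i \<tau> \<le> \<sigma>" "0 \<le> \<sigma>"
  shows "real (length bins) * B \<le> B + (\<Sum>i\<in>I. delta d i \<tau>)"
    and "(\<Sum>i\<in>I. delta d i \<tau>) \<le> real (length bins) * (B + \<sigma>)"
proof -
  let ?w = "\<lambda>i. delta d i \<tau>"
  obtain xs ys as bs ra rb where
    xs: "distinct xs" "set xs = {i\<in>I. real (d i) \<le> \<tau>}" and
    ys: "distinct ys" "set ys = {i\<in>I. real (d i) > \<tau>}" and
    pa: "peel ?w B xs as ra" and pb: "peel ?w B ys bs rb" and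
    bins: "bins = map (\<lambda>b. (set b, real (d (last b)))) (as @ bs) @
               remainder_bins d B \<tau> (set ra) (set rb)"
    using assms(1) by (auto simp: refined_bins_def)
  note cx = peel_concat[OF pa] and cy = peel_concat[OF pb]
  have disj: "set xs \<inter> set ys = {}" and I: "I = set xs \<union> set ys" using xs(2) ys(2) by auto
  have sI: "(\<Sum>i\<in>I. ?w i) = sum_list (map ?w xs) + sum_list (map ?w ys)"
    using xs(1) ys(1) disj by (simp add: I sum.union_disjoint sum_list_distinct_conv_sum_set)
  have dr: "distinct ra" "distinct rb" "set ra \<inter> set rb = {}"
    using xs(1) ys(1) disj unfolding cx cy by auto
  have sr: "(\<Sum>i\<in>set ra \<union> set rb. ?w i) = sum_list (map ?w ra) + sum_list (map ?w rb)"
    using dr by (simp add: sum.union_disjoint sum_list_distinct_conv_sum_set)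
  let ?r = "length (remainder_bins d B \<tau> (set ra) (set rb))"
  have rest: "(\<Sum>i\<in>set ra. ?w i) \<le> B" "(\<Sum>i\<in>set rb. ?w i) \<le> B"
    using peel_rest[OF pa] peel_rest[OF pb] dr by (simp_all add: sum_list_distinct_conv_sum_set)
  note r = remainder_bins_length[OF _ _ assms(2) rest, unfolded sr]
  have len: "real (length bins) = length as + length bs + ?r" by (simp add: bins)
  have w: "?w i \<le> \<sigma>" if "i \<in> set xs \<union> set ys" for i using that assms(3) I by blast
  have wa: "\<And>x. x \<in> set xs \<Longrightarrow> ?w x \<le> \<sigma>" and wb: "\<And>x. x \<in> set ys \<Longrightarrow> ?w x \<le> \<sigma>"
    using w by auto
  show "real (length bins) * B \<le> B + (\<Sum>i\<in>I. delta d i \<tau>)"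
    using r(1) peel_weight(1)[OF pa assms(2) wa] peel_weight(1)[OF pb assms(2) wb]
    unfolding len sI by (simp add: distrib_right)
  \<comment> \<open>Remainder bins stay within \<open>B\<close>; \<open>0 \<le> \<sigma>\<close>
    allows counting them with the capacity \<open>B + \<sigma>\<close> of the peeled ones.\<close>
  have "0 \<le> ?r * \<sigma>" using assms(4) by simp
  then show "(\<Sum>i\<in>I. delta d i \<tau>) \<le> real (length bins) * (B + \<sigma>)"
    using r(2) peel_weight(2)[OF pa assms(2) wa] peel_weight(2)[OF pb assms(2) wb]
    unfolding len sI by (simp add: distrib_right distrib_left)
qed

lemma refined_bins_exist:
  assumes "finite I" "0 < B"
  shows "\<exists>bins. refined_bins d B \<tau> I bins"
proof -
  define xs where "xs = sort_key d (sorted_list_of_set {i\<in>I. real (d i) \<le> \<tau>})"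
  define ys where "ys = rev (sort_key d (sorted_list_of_set {i\<in>I. real (d i) > \<tau>}))"
  obtain as ra bs rb where "peel (\<lambda>i. delta d i \<tau>) B xs as ra" "peel (\<lambda>i. delta d i \<tau>) B ys bs rb"
    using peel_exists[OF assms(2)] by metis
  moreover have "sorted_wrt (\<lambda>i j. d i \<le> d j) xs"
    using sorted_sort_key[of d] by (simp add: xs_def sorted_map)
  moreover have "sorted_wrt (\<lambda>i j. d i \<ge> d j) ys"
    using sorted_sort_key[of d] by (simp add: ys_def sorted_map sorted_wrt_rev)
  moreover have "distinct xs" "set xs = {i\<in>I. real (d i) \<le> \<tau>}"
    "distinct ys" "set ys = {i\<in>I. real (d i) > \<tau>}"
    using assms(1) by (auto simp: xs_def ys_def)
  ultimately show ?thesis unfolding refined_bins_def by blast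
qed

text \<open>The packing rule enters the analysis only through its number of bins: a single bin
  certifies that everything fits at \<open>\<tau>\<close>, and two or more trigger the refinement.
  The later estimates are therefore the same for both rules.\<close>

lemma bins_at_cases:
  assumes "bins_at rule d B \<tau> I bins" "\<And>i. i \<in> I \<Longrightarrow> delta d i \<tau> \<le> B"
  obtains "I = {}" "bins = []"
  | "I \<noteq> {}" "bins = [(I, \<tau>)]" "(\<Sum>i\<in>I. delta d i \<tau>) \<le> B"
  | "I \<noteq> {}" "refined_bins d B \<tau> I bins"
proof -
  let ?w = "\<lambda>i. delta d i \<tau>"
  obtain xs where xs: "distinct xs" "set xs = I" and
    bins: "let P = first_fit ?w B xs in
         if length P \<ge> 2 then refined_bins d B \<tau> I bins else bins = map (\<lambda>b. (set b, \<tau>)) P"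
    using assms(1) by (auto simp: bins_at_def)
  define P where "P = first_fit ?w B xs"
  have P: "mset (concat P) = mset xs" "\<And>b. b \<in> set P \<Longrightarrow> sum_list (map ?w b) \<le> B"
    using first_fit_correct[of xs ?w B] assms(2) xs(2) by (auto simp: P_def)
  consider "P = []" | b where "P = [b]" | "length P \<ge> 2"
    by (cases P rule: remdups_adj.cases) auto
  then show thesis
  proof cases
    case 1
    then have "I = {}" using P(1) xs(2) by simp
    then show thesis using that(1) bins 1 by (simp add: P_def[symmetric])
  next
    case 2
    then have b: "mset b = mset xs" "set b = I" "distinct b"
      using P(1) xs by (auto dest: mset_eq_setD mset_eq_imp_distinct_iff)
    have "bins = [(I, \<tau>)]" using 2 bins b by (simp add: P_def[symmetric])
    moreover have "(\<Sum>i\<in>I. ?w i) \<le> B"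
      using P(2)[of b] 2 b by (simp add: sum_list_distinct_conv_sum_set)
    moreover have "I \<noteq> {}"
    proof -
      have "b \<noteq> []" using first_fit_correct(2)[of xs ?w B b] assms(2) xs(2) 2 by (auto simp: P_def)
      then show ?thesis using b(2) by auto
    qed
    ultimately show thesis using that(2) by blast
  next
    case 3
    then have "xs \<noteq> []" using P_def by (auto simp: first_fit_def)
    then show thesis using that(3) bins 3 xs(2) by (auto simp: P_def[symmetric] Let_def)
  qed
qed

lemma bins_at_feasible:
  assumes "bins_at rule d B \<tau> I bins" "\<And>i. i \<in> I \<Longrightarrow> delta d i \<tau> \<le> B" "0 < B" "0 \<le> \<tau>"
  shows "feasible_on I d B bins"
  by (rule bins_at_cases[OF assms(1,2)])
    (use assms feasible_on_Nil feasible_on_single refined_bins_feasible in auto)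

lemma bins_at_length_le:
  assumes "bins_at rule d B \<tau> I bins" "\<And>i. i \<in> I \<Longrightarrow> delta d i \<tau> \<le> B" "0 < B"
  shows "real (length bins) * B \<le> B + (\<Sum>i\<in>I. delta d i \<tau>)"
proof (rule bins_at_cases[OF assms(1,2)])
  assume "refined_bins d B \<tau> I bins"
  then show ?thesis using refined_bins_length(1) assms(2,3) by (meson less_imp_le)
qed (use assms(3) in \<open>auto simp: sum_nonneg delta_nonneg\<close>)

text \<open>Overfull peeled bins gain at most one item. If all items are small compared with
  \<open>B\<close>, a heavily loaded time still needs about as many bins as its load divided by
  \<open>B\<close>; the tightness proof rests on this.\<close>

lemma bins_at_length_ge:
  assumes "bins_at rule d B \<tau> I bins" "\<And>i. i \<in> I \<Longrightarrow> delta d i \<tau> \<le> \<sigma>"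
    and "0 < B" "0 \<le> \<sigma>" "\<sigma> \<le> B"
  shows "(\<Sum>i\<in>I. delta d i \<tau>) \<le> real (length bins) * (B + \<sigma>)"
proof (rule bins_at_cases[OF assms(1)])
  assume "refined_bins d B \<tau> I bins"
  then show ?thesis using refined_bins_length(2) assms(2,3,4) by blast
qed (use assms in \<open>auto intro: order_trans\<close>)

lemma bins_at_nonempty:
  assumes "bins_at rule d B \<tau> I bins" "\<And>i. i \<in> I \<Longrightarrow> delta d i \<tau> \<le> B" "0 < B" "0 \<le> \<tau>" "I \<noteq> {}"
  shows "0 < length bins"
  using bins_at_feasible[OF assms(1-4)] assms(5)
  by (auto simp: feasible_on_def partition_on_def)

lemma bins_at_exist:
  assumes "finite I" "0 < B"
  shows "\<exists>bins. bins_at rule d B \<tau> I bins"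
proof -
  define xs where "xs = rev (sort_key (\<lambda>i. delta d i \<tau>) (sorted_list_of_set I))"
  have "sorted_wrt (\<lambda>x y. delta d x \<tau> \<ge> delta d y \<tau>) xs"
    using sorted_sort_key[of "\<lambda>i. delta d i \<tau>"] by (simp add: xs_def sorted_map sorted_wrt_rev)
  then have "packing_order rule (\<lambda>i. delta d i \<tau>) xs" by (cases rule) auto
  moreover have "distinct xs" "set xs = I" using assms(1) by (auto simp: xs_def)
  moreover obtain r where r: "refined_bins d B \<tau> I r" using refined_bins_exist[OF assms] by blast
  moreover define P where "P = first_fit (\<lambda>i. delta d i \<tau>) B xs"
  ultimately have "bins_at rule d B \<tau> I (if length P \<ge> 2 then r else map (\<lambda>b. (set b, \<tau>)) P)"
    unfolding bins_at_def Let_def P_def by (intro exI[of _ xs]) simp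
  then show ?thesis by blast
qed

section \<open>Optimal sets of times\<close>

lemma delta_set_le: "\<lbrakk>finite V; \<tau> \<in> V\<rbrakk> \<Longrightarrow> delta_set d i V \<le> delta d i \<tau>"
  by (simp add: delta_set_def)

lemma delta_set_attained:
  assumes "finite V" "V \<noteq> {}"
  obtains \<tau> where "\<tau> \<in> V" "delta d i \<tau> = delta_set d i V"
proof -
  have "delta_set d i V \<in> (\<lambda>\<tau>. delta d i \<tau>) ` V"
    unfolding delta_set_def using assms by (intro Min_in) auto
  then show thesis using that by (metis imageE)
qed

text \<open>The subproblem demands exactly \<open>k\<close> distinct times, while the constructions
  below yield at most \<open>k\<close>. Additional times can only shorten the distances.\<close>

lemma extend_times:
  fixes W :: "real set"
  assumes "finite W" "card W \<le> k" "\<forall>\<tau>\<in>W. 0 \<le> \<tau>"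
  obtains V where "W \<subseteq> V" "finite V" "card V = k" "\<forall>\<tau>\<in>V. 0 \<le> \<tau>"
proof -
  have "infinite ({0::real..} - W)" using assms(1) infinite_Ici[of "0::real"] by simp
  then obtain X where X: "finite X" "card X = k - card W" "X \<subseteq> {0..} - W"
    using infinite_arbitrarily_large by blast
  then have "card (W \<union> X) = k" using assms card_Un_disjoint[of W X] by auto
  then show thesis using that[of "W \<union> X"] X assms by auto
qed

lemma extend_to_ET_feasible:
  assumes "finite W" "card W \<le> k" "\<forall>\<tau>\<in>W. 0 \<le> \<tau>"
    and "\<And>i. i \<in> {1..n} \<Longrightarrow> \<exists>\<tau>\<in>W. delta d i \<tau> \<le> B"
  obtains V where "W \<subseteq> V" "ET_feasible n d B k V"
proof -
  obtain V where V: "W \<subseteq> V" "finite V" "card V = k" "\<forall>\<tau>\<in>V. 0 \<le> \<tau>"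
    using extend_times assms(1-3) by blast
  have "delta_set d i V \<le> B" if i: "i \<in> {1..n}" for i
  proof -
    obtain \<tau> where \<tau>: "\<tau> \<in> W" "delta d i \<tau> \<le> B" using assms(4)[OF i] by blast
    then have "delta_set d i V \<le> delta d i \<tau>" using V by (intro delta_set_le) auto
    then show ?thesis using \<tau> by simp
  qed
  then show thesis using that V by (auto simp: ET_feasible_def)
qed

text \<open>Compactness: one item of \<open>S\<close> confines the admissible times to a bounded
  interval, the constraints are closed, and the cost is continuous. For an empty cluster any time
  will do.\<close>

lemma cluster_optimum:
  assumes "finite S" "0 \<le> t0" "\<forall>i\<in>S. delta d i t0 \<le> B"
  shows "\<exists>t\<ge>0. (\<forall>i\<in>S. delta d i t \<le> B) \<and>
    (\<forall>t'\<ge>0. (\<forall>i\<in>S. delta d i t' \<le> B) \<longrightarrow> (\<Sum>i\<in>S. delta d i t) \<le> (\<Sum>i\<in>S. delta d i t'))"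
proof (cases "S = {}")
  case False
  then obtain i0 where i0: "i0 \<in> S" by blast
  \<comment> \<open>The upper end is implied by the constraint of \<open>i0\<close> and makes the
    boundedness explicit.\<close>
  define T where "T = {0..real (d i0) + B} \<inter> (\<Inter>i\<in>S. {t. delta d i t \<le> B})"
  have T: "t \<in> T \<longleftrightarrow> 0 \<le> t \<and> (\<forall>i\<in>S. delta d i t \<le> B)" for t
    using i0 by (fastforce simp: T_def delta_def)
  have "compact T" unfolding T_def
    by (intro compact_Int_closed compact_Icc closed_INT ballI closed_Collect_le)
      (auto simp: delta_def intro!: continuous_intros)
  moreover have "T \<noteq> {}" using T assms by blast
  moreover have "continuous_on T (\<lambda>t. \<Sum>i\<in>S. delta d i t)"
    unfolding delta_def by (intro continuous_intros)
  ultimately obtain t where "t \<in> T" "\<forall>t'\<in>T. (\<Sum>i\<in>S. delta d i t) \<le> (\<Sum>i\<in>S. delta d i t')"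
    using continuous_attains_inf by blast
  then show ?thesis using T by blast
qed auto

text \<open>For a fixed assignment of the items to \<open>k\<close> slots the times can be optimized slot by slot,
  and there are only finitely many assignments.\<close>

lemma ET_optimal_exists:
  assumes "ET_feasible n d B k V0" "1 \<le> k"
  shows "\<exists>V. ET_optimal n d B k V"
proof -
  \<comment> \<open>The slot times \<open>\<tau> j\<close> need not be distinct. This decouples the
    slots from each other and keeps each set of admissible times closed.\<close>
  define adm where "adm = (\<lambda>(\<sigma> :: nat \<Rightarrow> nat) \<tau>. (\<forall>j<k. 0 \<le> \<tau> j) \<and> (\<forall>i\<in>{1..n}. delta d i (\<tau> (\<sigma> i)) \<le> B))"
  define cost where "cost = (\<lambda>(\<sigma> :: nat \<Rightarrow> nat) \<tau>. \<Sum>i\<in>{1..n}. delta d i (\<tau> (\<sigma> i)))"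
  define \<Phi> where "\<Phi> = {\<sigma> \<in> {1..n} \<rightarrow>\<^sub>E {..<k}. \<exists>\<tau>. adm \<sigma> \<tau>}"
  have fin: "finite \<Phi>"
    by (rule finite_subset[of _ "{1..n} \<rightarrow>\<^sub>E {..<k}"]) (auto simp: \<Phi>_def intro!: finite_PiE)
  \<comment> \<open>Sending every item to a nearest time turns a set of times into an assignment of
    the same cost, so the best assignment is at least as good as any set.\<close>
  have from_V: "\<exists>\<sigma> \<tau>. \<sigma> \<in> \<Phi> \<and> adm \<sigma> \<tau> \<and> cost \<sigma> \<tau> = (\<Sum>i\<in>{1..n}. delta_set d i V)"
    if V: "ET_feasible n d B k V" for V
  proof -
    have fV: "finite V" "card V = k" "\<forall>\<tau>\<in>V. 0 \<le> \<tau>" "\<forall>i\<in>{1..n}. delta_set d i V \<le> B"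
      using V by (auto simp: ET_feasible_def)
    obtain \<tau> where \<tau>: "bij_betw \<tau> {0..<k} V" using ex_bij_betw_nat_finite[OF fV(1)] fV(2) by blast
    have "\<exists>j<k. delta d i (\<tau> j) = delta_set d i V" for i
    proof -
      have "V \<noteq> {}" using fV(2) assms(2) by auto
      then obtain t where "t \<in> V" "delta d i t = delta_set d i V"
        using delta_set_attained[OF fV(1)] by blast
      then show ?thesis using \<tau> by (force simp: bij_betw_def)
    qed
    then obtain s where s: "\<And>i. s i < k" "\<And>i. delta d i (\<tau> (s i)) = delta_set d i V" by metis
    let ?\<sigma> = "restrict s {1..n}"
    have "adm ?\<sigma> \<tau>" using \<tau> fV s(2) by (auto simp: adm_def bij_betw_def)
    moreover have "?\<sigma> \<in> {1..n} \<rightarrow>\<^sub>E {..<k}" using s(1) by auto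
    moreover have "cost ?\<sigma> \<tau> = (\<Sum>i\<in>{1..n}. delta_set d i V)"
      unfolding cost_def using s(2) by (intro sum.cong) auto
    ultimately show ?thesis unfolding \<Phi>_def by blast
  qed
  have slots: "\<exists>\<tau>. adm \<sigma> \<tau> \<and> (\<forall>\<tau>'. adm \<sigma> \<tau>' \<longrightarrow> cost \<sigma> \<tau> \<le> cost \<sigma> \<tau>')" if \<sigma>: "\<sigma> \<in> \<Phi>" for \<sigma>
  proof -
    let ?S = "\<lambda>j. {i\<in>{1..n}. \<sigma> i = j}"
    obtain \<tau>0 where \<tau>0: "adm \<sigma> \<tau>0" using \<sigma> by (auto simp: \<Phi>_def)
    have \<sigma>k: "\<sigma> ` {1..n} \<subseteq> {..<k}" using \<sigma> by (auto simp: \<Phi>_def)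
    have split: "cost \<sigma> \<tau> = (\<Sum>j<k. \<Sum>i\<in>?S j. delta d i (\<tau> j))" for \<tau>
    proof -
      have "(\<Sum>j<k. \<Sum>i\<in>?S j. delta d i (\<tau> j)) = (\<Sum>j<k. \<Sum>i\<in>?S j. delta d i (\<tau> (\<sigma> i)))"
        by (intro sum.cong) auto
      also have "\<dots> = cost \<sigma> \<tau>" unfolding cost_def using \<sigma>k by (intro sum.group) auto
      finally show ?thesis by simp
    qed
    have "\<exists>t\<ge>0. (\<forall>i\<in>?S j. delta d i t \<le> B) \<and>
      (\<forall>t'\<ge>0. (\<forall>i\<in>?S j. delta d i t' \<le> B) \<longrightarrow>
        (\<Sum>i\<in>?S j. delta d i t) \<le> (\<Sum>i\<in>?S j. delta d i t'))" if "j < k" for j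
      using \<tau>0 that by (intro cluster_optimum[of _ "\<tau>0 j"]) (auto simp: adm_def)
    then have "\<forall>j\<in>{..<k}. \<exists>t. 0 \<le> t \<and> (\<forall>i\<in>?S j. delta d i t \<le> B) \<and>
      (\<forall>t'\<ge>0. (\<forall>i\<in>?S j. delta d i t' \<le> B) \<longrightarrow>
        (\<Sum>i\<in>?S j. delta d i t) \<le> (\<Sum>i\<in>?S j. delta d i t'))" by blast
    from bchoice[OF this] obtain \<tau> where \<tau>: "\<And>j. j < k \<Longrightarrow> 0 \<le> \<tau> j"
      "\<And>j i. j < k \<Longrightarrow> i \<in> ?S j \<Longrightarrow> delta d i (\<tau> j) \<le> B"
      "\<And>j t'. \<lbrakk>j < k; 0 \<le> t'; \<forall>i\<in>?S j. delta d i t' \<le> B\<rbrakk> \<Longrightarrow>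
        (\<Sum>i\<in>?S j. delta d i (\<tau> j)) \<le> (\<Sum>i\<in>?S j. delta d i t')"
      by blast
    have "adm \<sigma> \<tau>" using \<tau>(1,2) \<sigma>k by (auto simp: adm_def image_subset_iff)
    moreover have "cost \<sigma> \<tau> \<le> cost \<sigma> \<tau>'" if "adm \<sigma> \<tau>'" for \<tau>'
      unfolding split using that by (intro sum_mono \<tau>(3)) (auto simp: adm_def)
    ultimately show ?thesis by blast
  qed
  then have "\<forall>\<sigma>\<in>\<Phi>. \<exists>\<tau>. adm \<sigma> \<tau> \<and> (\<forall>\<tau>'. adm \<sigma> \<tau>' \<longrightarrow> cost \<sigma> \<tau> \<le> cost \<sigma> \<tau>')" by blast
  from bchoice[OF this] obtain opt where opt: "\<And>\<sigma>. \<sigma> \<in> \<Phi> \<Longrightarrow> adm \<sigma> (opt \<sigma>)"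
    "\<And>\<sigma> \<tau>. \<lbrakk>\<sigma> \<in> \<Phi>; adm \<sigma> \<tau>\<rbrakk> \<Longrightarrow> cost \<sigma> (opt \<sigma>) \<le> cost \<sigma> \<tau>"
    by blast
  have "\<Phi> \<noteq> {}" using from_V[OF assms(1)] by blast
  from ex_is_arg_min_if_finite[OF fin this, of "\<lambda>\<sigma>. cost \<sigma> (opt \<sigma>)"]
  obtain \<sigma> where \<sigma>: "\<sigma> \<in> \<Phi>" "\<And>\<sigma>'. \<sigma>' \<in> \<Phi> \<Longrightarrow> cost \<sigma> (opt \<sigma>) \<le> cost \<sigma>' (opt \<sigma>')"
    unfolding is_arg_min_linorder by blast
  define \<tau> where "\<tau> = opt \<sigma>"
  have \<tau>: "adm \<sigma> \<tau>" "\<sigma> ` {1..n} \<subseteq> {..<k}" using opt(1) \<sigma>(1) by (auto simp: \<tau>_def \<Phi>_def)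
  \<comment> \<open>Coinciding slot times leave fewer than \<open>k\<close> values, so the set is
    padded to size \<open>k\<close>.\<close>
  obtain V where V: "\<tau> ` {..<k} \<subseteq> V" "ET_feasible n d B k V"
  proof (rule extend_to_ET_feasible)
    show "finite (\<tau> ` {..<k})" "card (\<tau> ` {..<k}) \<le> k" "\<forall>t\<in>\<tau> ` {..<k}. 0 \<le> t"
      using \<tau> card_image_le[of "{..<k}" \<tau>] by (auto simp: adm_def)
    show "\<exists>t\<in>\<tau> ` {..<k}. delta d i t \<le> B" if "i \<in> {1..n}" for i
      using \<tau> that by (intro bexI[of _ "\<tau> (\<sigma> i)"] imageI) (auto simp: adm_def image_subset_iff)
  qed
  \<comment> \<open>\<open>V\<close> contains every slot time, so nearest times in \<open>V\<close>
    are no farther than the assigned ones.\<close>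
  have "(\<Sum>i\<in>{1..n}. delta_set d i V) \<le> cost \<sigma> \<tau>"
    unfolding cost_def using V \<tau>(2) by (intro sum_mono delta_set_le) (auto simp: ET_feasible_def image_subset_iff)
  moreover have "cost \<sigma> \<tau> \<le> (\<Sum>i\<in>{1..n}. delta_set d i V')" if V': "ET_feasible n d B k V'" for V'
  proof -
    obtain \<sigma>' \<tau>' where "\<sigma>' \<in> \<Phi>" "adm \<sigma>' \<tau>'" "cost \<sigma>' \<tau>' = (\<Sum>i\<in>{1..n}. delta_set d i V')"
      using from_V[OF V'] by blast
    then show ?thesis using \<sigma>(2)[of \<sigma>'] opt(2)[of \<sigma>' \<tau>'] by (simp add: \<tau>_def)
  qed
  ultimately have "ET_optimal n d B k V"
    using V(2) order_trans unfolding ET_optimal_def is_arg_min_linorder by blast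
  then show ?thesis by blast
qed

section \<open>The approximation guarantee\<close>

lemma ET_optimalD:
  assumes "ET_optimal n d B k V"
  shows "ET_feasible n d B k V"
    and "ET_feasible n d B k V' \<Longrightarrow> (\<Sum>i\<in>{1..n}. delta_set d i V) \<le> (\<Sum>i\<in>{1..n}. delta_set d i V')"
  using assms by (auto simp: ET_optimal_def is_arg_min_linorder)

lemma decouple_and_refineE:
  assumes "decouple_and_refine rule n d B k sol"
  obtains V a bins where "ET_optimal n d B k V" "finite V" "card V = k" "\<And>\<tau>. \<tau> \<in> V \<Longrightarrow> 0 \<le> \<tau>"
    and "\<And>i. i \<in> {1..n} \<Longrightarrow> a i \<in> V"
    and "\<And>i. i \<in> {1..n} \<Longrightarrow> delta d i (a i) = delta_set d i V"
    and "\<And>i. i \<in> {1..n} \<Longrightarrow> delta d i (a i) \<le> B"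
    and "\<And>\<tau>. \<tau> \<in> V \<Longrightarrow> bins_at rule d B \<tau> {i\<in>{1..n}. a i = \<tau>} (bins \<tau>)"
    and "sol = concat (map bins (sorted_list_of_set V))"
    and "length sol = (\<Sum>\<tau>\<in>V. length (bins \<tau>))"
proof -
  obtain V a bins where *: "ET_optimal n d B k V"
    "\<forall>i\<in>{1..n}. a i \<in> V \<and> delta d i (a i) = delta_set d i V"
    "\<forall>\<tau>\<in>V. bins_at rule d B \<tau> {i\<in>{1..n}. a i = \<tau>} (bins \<tau>)"
    "sol = concat (map bins (sorted_list_of_set V))"
    using assms unfolding decouple_and_refine_def by blast
  have V: "finite V" "card V = k" "\<forall>\<tau>\<in>V. 0 \<le> \<tau>" "\<forall>i\<in>{1..n}. delta_set d i V \<le> B"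
    using ET_optimalD(1)[OF *(1)] by (auto simp: ET_feasible_def)
  have "length sol = sum_list (map (\<lambda>\<tau>. length (bins \<tau>)) (sorted_list_of_set V))"
    unfolding *(4) by (simp add: length_concat o_def)
  also have "\<dots> = (\<Sum>\<tau>\<in>V. length (bins \<tau>))"
    using V(1) by (simp add: sum_list_distinct_conv_sum_set)
  finally have len: "length sol = (\<Sum>\<tau>\<in>V. length (bins \<tau>))" .
  have le: "delta d i (a i) \<le> B" if "i \<in> {1..n}" for i
    using bspec[OF *(2) that] bspec[OF V(4) that] by simp
  show thesis
    by (rule that[OF *(1) V(1,2) bspec[OF V(3)] conjunct1[OF bspec[OF *(2)]]
          conjunct2[OF bspec[OF *(2)]] le bspec[OF *(3)] *(4) len])
qed

lemma decouple_and_refine_feasible: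
  assumes "decouple_and_refine rule n d B k sol" "0 < B"
  shows "feasible_solution n d B sol"
  using assms(1)
proof (rule decouple_and_refineE)
  fix V a bins
  assume V: "finite V" "\<And>\<tau>. \<tau> \<in> V \<Longrightarrow> 0 \<le> \<tau>" "\<And>i. i \<in> {1..n} \<Longrightarrow> a i \<in> V"
    "\<And>i. i \<in> {1..n} \<Longrightarrow> delta d i (a i) \<le> B"
    "\<And>\<tau>. \<tau> \<in> V \<Longrightarrow> bins_at rule d B \<tau> {i\<in>{1..n}. a i = \<tau>} (bins \<tau>)"
    and sol: "sol = concat (map bins (sorted_list_of_set V))"
  have "feasible_on (\<Union>\<tau>\<in>set (sorted_list_of_set V). {i\<in>{1..n}. a i = \<tau>}) d B sol"
    unfolding sol
  proof (rule feasible_on_concat)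
    show "feasible_on {i\<in>{1..n}. a i = \<tau>} d B (bins \<tau>)" if "\<tau> \<in> set (sorted_list_of_set V)" for \<tau>
      using that V assms(2) by (intro bins_at_feasible[OF V(5)]) auto
  qed auto
  moreover have "(\<Union>\<tau>\<in>set (sorted_list_of_set V). {i\<in>{1..n}. a i = \<tau>}) = {1..n}"
    using V by auto
  ultimately show ?thesis by (simp add: feasible_solution_iff)
qed

text \<open>The sizes assigned to the times of \<open>V\<close> add up to the optimal cost of the
  subproblem, which is at most the cost of any competitor. Later \<open>V'\<close> consists of the
  delivery times of a solution with the fewest bins.\<close>

lemma decouple_and_refine_length:
  assumes "decouple_and_refine rule n d B k sol" "0 < B" "ET_feasible n d B k V'"
  shows "real (length sol) * B \<le> real k * B + (\<Sum>i\<in>{1..n}. delta_set d i V')"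
  using assms(1)
proof (rule decouple_and_refineE)
  fix V a bins
  assume opt: "ET_optimal n d B k V"
    and V: "finite V" "card V = k" "\<And>i. i \<in> {1..n} \<Longrightarrow> a i \<in> V"
    "\<And>i. i \<in> {1..n} \<Longrightarrow> delta d i (a i) = delta_set d i V"
    "\<And>i. i \<in> {1..n} \<Longrightarrow> delta d i (a i) \<le> B"
    "\<And>\<tau>. \<tau> \<in> V \<Longrightarrow> bins_at rule d B \<tau> {i\<in>{1..n}. a i = \<tau>} (bins \<tau>)"
    and len: "length sol = (\<Sum>\<tau>\<in>V. length (bins \<tau>))"
  let ?I = "\<lambda>\<tau>. {i\<in>{1..n}. a i = \<tau>}"
  have "real (length sol) * B = (\<Sum>\<tau>\<in>V. real (length (bins \<tau>)) * B)"
    by (simp add: len sum_distrib_right)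
  also have "\<dots> \<le> (\<Sum>\<tau>\<in>V. B + (\<Sum>i\<in>?I \<tau>. delta d i \<tau>))"
    using V assms(2) by (intro sum_mono bins_at_length_le[OF V(6)]) auto
  also have "\<dots> = real k * B + (\<Sum>\<tau>\<in>V. \<Sum>i\<in>?I \<tau>. delta d i (a i))"
    using V(2) by (simp add: sum.distrib)
  also have "(\<Sum>\<tau>\<in>V. \<Sum>i\<in>?I \<tau>. delta d i (a i)) = (\<Sum>i\<in>{1..n}. delta d i (a i))"
    using V by (intro sum.group) auto
  also have "\<dots> = (\<Sum>i\<in>{1..n}. delta_set d i V)" using V(4) by (intro sum.cong) auto
  also have "\<dots> \<le> (\<Sum>i\<in>{1..n}. delta_set d i V')" using ET_optimalD(2)[OF opt assms(3)] .
  finally show ?thesis by simp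
qed

lemma decouple_and_refine_exists:
  assumes "ET_feasible n d B k V0" "1 \<le> k" "0 < B"
  shows "\<exists>sol. decouple_and_refine rule n d B k sol"
proof -
  obtain V where V: "ET_optimal n d B k V" using ET_optimal_exists[OF assms(1,2)] by blast
  have fV: "finite V" "card V = k" using ET_optimalD(1)[OF V] by (auto simp: ET_feasible_def)
  then have "V \<noteq> {}" using assms(2) by auto
  then have "\<forall>i. \<exists>\<tau>. \<tau> \<in> V \<and> delta d i \<tau> = delta_set d i V"
    using delta_set_attained[OF fV(1)] by blast
  from choice[OF this] obtain a where a: "\<And>i. a i \<in> V \<and> delta d i (a i) = delta_set d i V"
    by blast
  have "\<forall>\<tau>. \<exists>bins. bins_at rule d B \<tau> {i\<in>{1..n}. a i = \<tau>} bins"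
    using assms(3) by (intro allI bins_at_exist) auto
  from choice[OF this]
  obtain bins where "\<And>\<tau>. bins_at rule d B \<tau> {i\<in>{1..n}. a i = \<tau>} (bins \<tau>)" by blast
  then show ?thesis unfolding decouple_and_refine_def using V a by blast
qed

section \<open>Feasible solutions as candidates for the subproblem\<close>

text \<open>Each item alone in a bin, delivered at its own due time, costs nothing.\<close>

lemma feasible_solution_exists:
  assumes "0 < B"
  shows "\<exists>sol. feasible_solution n d B sol"
proof -
  let ?bs = "map (\<lambda>i. [i]) [1..<Suc n]"
  have c: "concat ?bs = [1..<Suc n]" by (simp only: concat_map_singleton map_ident)
  have "feasible_on (set (concat ?bs)) d B (map (\<lambda>b. (set b, real (d (hd b)))) ?bs)"
  proof (rule feasible_on_lists)
    show "distinct (concat ?bs)" unfolding c by simp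
  qed (use assms in \<open>auto simp: delta_def\<close>)
  moreover have "set (concat ?bs) = {1..n}"
    unfolding c by (simp only: set_upt atLeastLessThanSuc_atLeastAtMost)
  ultimately show ?thesis by (auto simp only: feasible_solution_iff)
qed

lemma min_bins_attained:
  assumes "0 < B"
  obtains sol where "feasible_solution n d B sol" "length sol = min_bins n d B"
proof -
  have "\<exists>m sol. feasible_solution n d B sol \<and> length sol = m"
    using feasible_solution_exists[OF assms] by blast
  from LeastI_ex[OF this] show thesis using that unfolding min_bins_def by blast
qed

lemma min_bins_le: "feasible_solution n d B sol \<Longrightarrow> min_bins n d B \<le> length sol"
  unfolding min_bins_def by (rule Least_le) blast

lemma card_partition_le:
  assumes "partition_on A P" "finite A"
  shows "card P \<le> card A"
proof -
  have P: "finite P" "\<And>S. S \<in> P \<Longrightarrow> finite S" "\<And>S. S \<in> P \<Longrightarrow> S \<noteq> {}"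
    using assms finite_elements by (auto simp: partition_on_def intro: finite_subset)
  have "card P = (\<Sum>S\<in>P. 1)" by simp
  also have "\<dots> \<le> (\<Sum>S\<in>P. card S)" using P by (intro sum_mono) (simp add: Suc_le_eq card_gt_0_iff)
  also have "\<dots> = card (\<Union>P)"
    using P assms by (intro card_Union_disjoint[symmetric]) (auto simp: partition_on_def)
  finally show ?thesis using assms by (simp add: partition_on_def)
qed

text \<open>Each bin pays at most \<open>B\<close> for its items at its own time, and nearest times
  are no worse. Bins may share a time, so \<open>card V\<close> is the right \<open>k\<close> and
  can be smaller than the number of bins; nonempty bins keep it within the range
  \<open>{1..n}\<close> tried by the algorithm.\<close>

lemma feasible_solution_times:
  assumes "feasible_solution n d B sol" "1 \<le> n"
  defines "V \<equiv> snd ` set sol"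
  shows "ET_feasible n d B (card V) V" "1 \<le> card V" "card V \<le> length sol" "length sol \<le> n"
    "(\<Sum>i\<in>{1..n}. delta_set d i V) \<le> real (length sol) * B"
proof -
  have dist: "distinct (map fst sol)" and part: "partition_on {1..n} (set (map fst sol))"
    and bins: "\<forall>(S, \<mu>)\<in>set sol. 0 \<le> \<mu> \<and> (\<Sum>i\<in>S. delta d i \<mu>) \<le> B"
    using assms(1) unfolding feasible_solution_def by blast+
  have bin: "0 \<le> \<mu> \<and> (\<Sum>i\<in>S. delta d i \<mu>) \<le> B" if "(S, \<mu>) \<in> set sol" for S \<mu>
    using bspec[OF bins that] by simp
  have fV: "finite V" by (simp add: V_def)
  have items: "\<Union> (set (map fst sol)) = {1..n}" using part by (simp add: partition_on_def)
  have fS: "finite S" if "(S, \<mu>) \<in> set sol" for S \<mu>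
  proof -
    have "S \<in> set (map fst sol)" using imageI[OF that, of fst] by simp
    then have "S \<subseteq> {1..n}" using items by blast
    then show ?thesis using finite_subset by blast
  qed
  have "delta_set d i V \<le> B" if i: "i \<in> {1..n}" for i
  proof -
    have "i \<in> \<Union> (fst ` set sol)" using i items by simp
    then obtain S \<mu> where S: "(S, \<mu>) \<in> set sol" "i \<in> S" by auto
    have "\<mu> \<in> V" using imageI[OF S(1), of snd] by (simp add: V_def)
    then have "delta_set d i V \<le> delta d i \<mu>" using fV by (intro delta_set_le)
    also have "\<dots> \<le> (\<Sum>i\<in>S. delta d i \<mu>)"
      using S(2) fS[OF S(1)] by (intro member_le_sum) (simp_all add: delta_nonneg)
    also have "\<dots> \<le> B" using bin[OF S(1)] by simp
    finally show ?thesis .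
  qed
  moreover have "\<forall>\<tau>\<in>V. 0 \<le> \<tau>" using bin by (auto simp: V_def)
  ultimately show "ET_feasible n d B (card V) V"
    using fV by (simp only: ET_feasible_def) blast
  have "sol \<noteq> []"
  proof
    assume "sol = []"
    then show False using items assms(2) by simp
  qed
  then show "1 \<le> card V" using fV by (simp add: V_def Suc_le_eq card_gt_0_iff)
  have "card V \<le> card (set sol)" unfolding V_def by (rule card_image_le) simp
  then show "card V \<le> length sol" using card_length[of sol] by linarith
  have "length sol = card (set (map fst sol))" using distinct_card[OF dist] by simp
  also have "\<dots> \<le> n" using card_partition_le[OF part] by simp
  finally show "length sol \<le> n" .
  have "\<forall>S\<in>set (map fst sol). finite S" using fS by auto
  moreover have "\<forall>S\<in>set (map fst sol). \<forall>T\<in>set (map fst sol). S \<noteq> T \<longrightarrow> S \<inter> T = {}"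
    using part by (simp add: partition_on_def disjoint_def)
  ultimately have "(\<Sum>i\<in>{1..n}. delta_set d i V) =
      (\<Sum>S\<in>set (map fst sol). \<Sum>i\<in>S. delta_set d i V)"
    using sum.Union_disjoint[of "set (map fst sol)" "\<lambda>i. delta_set d i V"]
    by (simp only: items o_def)
  also have "\<dots> = (\<Sum>p\<leftarrow>sol. \<Sum>i\<in>fst p. delta_set d i V)"
    using sum_list_distinct_conv_sum_set[OF dist, of "\<lambda>S. \<Sum>i\<in>S. delta_set d i V"]
    by (simp add: o_def)
  also have "\<dots> \<le> (\<Sum>p\<leftarrow>sol. B)"
  proof (rule sum_list_mono)
    fix p assume p: "p \<in> set sol"
    have "(\<Sum>i\<in>fst p. delta_set d i V) \<le> (\<Sum>i\<in>fst p. delta d i (snd p))"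
      using p fV by (intro sum_mono delta_set_le) (auto simp: V_def)
    then show "(\<Sum>i\<in>fst p. delta_set d i V) \<le> B" using bin[of "fst p" "snd p"] p by simp
  qed
  also have "\<dots> = real (length sol) * B" by (simp add: sum_list_triv)
  finally show "(\<Sum>i\<in>{1..n}. delta_set d i V) \<le> real (length sol) * B" .
qed

section \<open>Runs of the complete algorithm\<close>

lemma refined_decouplingE:
  assumes "refined_decoupling rule n d B sol"
  obtains k where "k \<in> {1..n}" "decouple_and_refine rule n d B k sol"
    and "\<And>k' V'. \<lbrakk>k' \<in> {1..n}; ET_feasible n d B k' V'\<rbrakk> \<Longrightarrow>
      \<exists>sol'. decouple_and_refine rule n d B k' sol' \<and> length sol \<le> length sol'"
proof -
  define K where "K = {k\<in>{1..n}. \<exists>V. ET_feasible n d B k V}"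
  obtain run k where run: "\<forall>k\<in>K. decouple_and_refine rule n d B k (run k)"
    "is_arg_min (\<lambda>k. length (run k)) (\<lambda>k. k \<in> K) k" "sol = run k"
    using assms unfolding refined_decoupling_def Let_def K_def by blast
  then have k: "k \<in> K" "\<And>k'. k' \<in> K \<Longrightarrow> length (run k) \<le> length (run k')"
    by (auto simp: is_arg_min_linorder)
  show thesis
  proof (rule that)
    show "k \<in> {1..n}" "decouple_and_refine rule n d B k sol" using k run by (auto simp: K_def)
    show "\<exists>sol'. decouple_and_refine rule n d B k' sol' \<and> length sol \<le> length sol'"
      if "k' \<in> {1..n}" "ET_feasible n d B k' V'" for k' V'
    proof -
      have "k' \<in> K" using that by (auto simp: K_def)
      then show ?thesis using k run by auto
    qed
  qed
qed

text \<open>Some \<open>k\<close> must be feasible for the minimum over \<open>k\<close> to exist;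
  the delivery times of any feasible solution provide one.\<close>

lemma refined_decoupling_exists:
  assumes "delivery_instance n d B"
  shows "\<exists>sol. refined_decoupling rule n d B sol"
proof -
  have nB: "1 \<le> n" "0 < B" using assms by (auto simp: delivery_instance_def)
  define K where "K = {k\<in>{1..n}. \<exists>V. ET_feasible n d B k V}"
  have "\<exists>sol. decouple_and_refine rule n d B k sol" if "k \<in> K" for k
    using that nB decouple_and_refine_exists by (auto simp: K_def)
  then have "\<forall>k\<in>K. \<exists>sol. decouple_and_refine rule n d B k sol" by blast
  from bchoice[OF this] obtain run where run: "\<forall>k\<in>K. decouple_and_refine rule n d B k (run k)"
    by blast
  obtain s where "feasible_solution n d B s" using feasible_solution_exists nB by blast
  note s = feasible_solution_times[OF this nB(1)]
  have "card (snd ` set s) \<in> K" using s(1,2,3,4) by (auto simp: K_def)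
  moreover have "finite K" by (simp add: K_def)
  ultimately obtain k where "is_arg_min (\<lambda>k. length (run k)) (\<lambda>k. k \<in> K) k"
    using ex_is_arg_min_if_finite[of K "\<lambda>k. length (run k)"] by blast
  then have "refined_decoupling rule n d B (run k)"
    using run unfolding refined_decoupling_def Let_def K_def by (intro exI[of _ run] exI[of _ k]) simp
  then show ?thesis by blast
qed

lemma refined_decoupling_two_approx:
  assumes "delivery_instance n d B" "refined_decoupling rule n d B sol"
  shows "length sol \<le> 2 * min_bins n d B"
proof -
  have nB: "1 \<le> n" "0 < B" using assms by (auto simp: delivery_instance_def)
  obtain s where s: "feasible_solution n d B s" "length s = min_bins n d B"
    using min_bins_attained nB by blast
  let ?V = "snd ` set s"
  note t = feasible_solution_times[OF s(1) nB(1)]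
  have "card ?V \<in> {1..n}" using t(2-4) by simp
  then obtain sol' where sol': "decouple_and_refine rule n d B (card ?V) sol'"
    "length sol \<le> length sol'"
    using t(1) by (rule_tac refined_decouplingE[OF assms(2)]) blast
  have "real (length sol') * B \<le> real (card ?V) * B + real (length s) * B"
    using decouple_and_refine_length[OF sol'(1) nB(2) t(1)] t(5) by linarith
  also have "\<dots> \<le> real (length s) * B + real (length s) * B"
    using t(3) nB by (intro add_right_mono mult_right_mono) auto
  finally have "real (length sol') * B \<le> (2 * real (length s)) * B"
    by (simp only: mult_2 distrib_right)
  then have "length sol' \<le> 2 * length s"
    using nB(2) by (simp only: mult_le_cancel_right_pos)
  then show ?thesis using sol'(2) s(2) by simp
qed

section \<open>Tightness\<close>

text \<open>Exchange argument: an element of \<open>S\<close> outside \<open>{..<k}\<close> weighs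
  at most \<open>q - k\<close>, an element of \<open>{..<k}\<close> missing from \<open>S\<close> at
  least \<open>q - k + 1\<close>. There are at least as many missing elements as outside ones, and
  at least one is missing.\<close>

lemma sum_initial_segment_gap:
  fixes k m q :: nat
  assumes "S \<subseteq> {..<m}" "card S \<le> k" "S \<noteq> {..<k}" "k \<le> m" "m \<le> q"
  shows "(\<Sum>j\<in>S. real q - real j) + 1 \<le> (\<Sum>j<k. real q - real j)"
proof -
  have fin: "finite S" using assms(1) finite_subset by blast
  let ?T = "{..<k}"
  have c: "card (S - ?T) \<le> card (?T - S)"
    using card_Int_Diff[of S ?T] card_Int_Diff[of ?T S] fin assms(2) by (simp add: Int_commute)
  have ne: "?T - S \<noteq> {}"
  proof
    assume "?T - S = {}"
    then have "?T \<subseteq> S" by blast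
    then have "?T = S" using assms(2) fin by (intro card_seteq) auto
    then show False using assms(3) by simp
  qed
  have "(\<Sum>j\<in>S - ?T. real q - real j) \<le> (\<Sum>j\<in>S - ?T. real q - real k)"
    by (intro sum_mono) auto
  also have "\<dots> = real (card (S - ?T)) * (real q - real k)" by simp
  also have "\<dots> \<le> real (card (?T - S)) * (real q - real k)"
    using c assms(4,5) by (intro mult_right_mono) auto
  finally have 1: "(\<Sum>j\<in>S - ?T. real q - real j) \<le> real (card (?T - S)) * (real q - real k)" .
  have "real (card (?T - S)) * (real q - real k + 1) = (\<Sum>j\<in>?T - S. real q - real k + 1)" by simp
  also have "\<dots> \<le> (\<Sum>j\<in>?T - S. real q - real j)"
    by (intro sum_mono) auto
  finally have 2: "real (card (?T - S)) * (real q - real k) + real (card (?T - S))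
      \<le> (\<Sum>j\<in>?T - S. real q - real j)" by (simp add: algebra_simps)
  have 3: "1 \<le> card (?T - S)" using ne by (simp add: Suc_le_eq card_gt_0_iff)
  have "(\<Sum>j\<in>S. real q - real j) = (\<Sum>j\<in>S \<inter> ?T. real q - real j) + (\<Sum>j\<in>S - ?T. real q - real j)"
    using fin by (rule sum.Int_Diff)
  moreover have "(\<Sum>j<k. real q - real j) =
      (\<Sum>j\<in>?T \<inter> S. real q - real j) + (\<Sum>j\<in>?T - S. real q - real j)"
    by (rule sum.Int_Diff) simp
  ultimately show ?thesis using 1 2 3 by (simp add: Int_commute)
qed

section \<open>The staircase instance\<close>

text \<open>\<open>R = 8 * b * q\<close> makes the relative error \<open>2 / R\<close>, applied to a
  weight of at most \<open>2 * b * q\<close> units, smaller than the gap of one unit.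
  \<open>q = 2 * b * (2 * b + 1)\<close> makes the shortfalls of up to \<open>2 * b\<close>
  positions against full bins add up to less than one bin.\<close>

locale staircase =
  fixes b q R n :: nat and p :: "nat \<Rightarrow> nat"
  assumes b: "1 \<le> b"
    and q: "q = 4 * b * b + 2 * b"
    and R: "R = 8 * b * q"
    and p: "i \<in> {1..n} \<Longrightarrow> p i < 2 * b"
    and multiplicity: "j < 2 * b \<Longrightarrow> card {i\<in>{1..n}. p i = j} = (q - j) * R ^ (2 * b - 1 - j)"
begin

definition x :: "nat \<Rightarrow> real" where "x j = real R ^ j"

definition W :: real where "W = x (2 * b - 1)"

definition C :: real where "C = real q * W"

definition d :: "nat \<Rightarrow> nat" where "d i = R ^ p i"

lemma q_ge: "2 * b < q" "1 \<le> q"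
  using b by (auto simp: q)

lemma R_ge: "8 * real b * real q \<le> real R" "2 \<le> real R"
proof -
  have "real R = 8 * real b * real q" by (simp add: R)
  moreover have "1 * 1 \<le> real b * real q" using b q_ge by (intro mult_mono) auto
  ultimately show "8 * real b * real q \<le> real R" "2 \<le> real R" by linarith+
qed

lemma delta_d: "delta d i \<tau> = \<bar>x (p i) - \<tau>\<bar>"
  by (simp add: delta_def d_def x_def)

lemma x_pos: "0 < x j"
  using R_ge by (simp add: x_def)

lemma x_mono: "i \<le> j \<Longrightarrow> x i \<le> x j"
  using R_ge by (simp add: x_def power_increasing)

lemma x_step: "i < j \<Longrightarrow> real R * x i \<le> x j"
  using x_mono[of "Suc i" j] by (simp add: x_def)

lemma W_pos: "0 < W" by (simp add: W_def x_pos)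

lemma C_pos: "0 < C" using W_pos q_ge by (simp add: C_def)

lemma x_le_W: "j < 2 * b \<Longrightarrow> x j \<le> W"
  unfolding W_def by (intro x_mono) simp

lemma W_le_C: "W \<le> C"
  using W_pos q_ge by (simp add: C_def)

text \<open>The factor \<open>R ^ (2 * b - 1 - j)\<close> in the multiplicity cancels the due time
  \<open>R ^ j\<close>, so positions differ only through \<open>q - j\<close>.\<close>

lemma weight:
  assumes "j < 2 * b"
  shows "real (card {i\<in>{1..n}. p i = j}) * x j = (real q - real j) * W"
proof -
  have "x (2 * b - 1 - j) * x j = W"
    using assms by (simp add: W_def x_def power_add[symmetric])
  moreover have "real (q - j) = real q - real j" using assms q_ge by simp
  ultimately show ?thesis
    using multiplicity[OF assms] by (simp add: x_def mult.assoc)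
qed

lemma sum_items: "(\<Sum>i\<in>{1..n}. f (p i)) = (\<Sum>j<2*b. real (card {i\<in>{1..n}. p i = j}) * f j)"
proof -
  have "(\<Sum>i\<in>{1..n}. f (p i)) = (\<Sum>j<2*b. \<Sum>i\<in>{i\<in>{1..n}. p i = j}. f (p i))"
    using p by (intro sum.group[symmetric]) auto
  also have "\<dots> = (\<Sum>j<2*b. \<Sum>i\<in>{i\<in>{1..n}. p i = j}. f j)"
    by (intro sum.cong) auto
  finally show ?thesis by simp
qed

lemma item_exists:
  assumes "j < 2 * b"
  shows "\<exists>i\<in>{1..n}. p i = j"
proof -
  have "card {i\<in>{1..n}. p i = j} \<noteq> 0"
    unfolding multiplicity[OF assms] using assms q_ge R_ge by auto
  then have "{i\<in>{1..n}. p i = j} \<noteq> {}" using card.empty by metis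
  then show ?thesis by blast
qed

lemma valid_instance: "delivery_instance n d C"
proof -
  obtain i where "i \<in> {1..n}" using item_exists[of 0] b by auto
  then have "1 \<le> n" by simp
  then show ?thesis using C_pos R_ge by (auto simp: delivery_instance_def d_def)
qed

text \<open>Bin \<open>c\<close> is delivered at position \<open>2 * c\<close>. Only position
  \<open>2 * c + 1\<close> pays, and at most its weight, which is below
  \<open>q * W = C\<close>.\<close>

lemma min_bins_le_b: "min_bins n d C \<le> b"
proof -
  let ?I = "\<lambda>c. {i\<in>{1..n}. p i div 2 = c}"
  let ?f = "\<lambda>c. [(?I c, x (2 * c))]"
  have single: "feasible_on (?I c) d C (?f c)" if c: "c < b" for c
  proof (rule feasible_on_single)
    obtain i where "i \<in> {1..n}" "p i = 2 * c" using item_exists[of "2 * c"] c by auto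
    then have "i \<in> ?I c" by simp
    then show "?I c \<noteq> {}" by blast
    show "0 \<le> x (2 * c)" using x_pos less_imp_le by blast
    let ?J = "{i\<in>{1..n}. p i = 2 * c + 1}"
    have "(\<Sum>i\<in>?I c. delta d i (x (2 * c))) = (\<Sum>i\<in>?J. delta d i (x (2 * c)))"
    proof (rule sum.mono_neutral_right)
      show "\<forall>i\<in>?I c - ?J. delta d i (x (2 * c)) = 0"
      proof
        fix i assume "i \<in> ?I c - ?J"
        then have "p i = 2 * c" by auto
        then show "delta d i (x (2 * c)) = 0" by (simp add: delta_d)
      qed
    qed auto
    also have "\<dots> \<le> (\<Sum>i\<in>?J. x (2 * c + 1))"
    proof (rule sum_mono)
      fix i assume "i \<in> ?J"
      then show "delta d i (x (2 * c)) \<le> x (2 * c + 1)"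
        using x_mono[of "2 * c" "2 * c + 1"] x_pos[of "2 * c"] by (simp add: delta_d)
    qed
    also have "\<dots> = (real q - real (2 * c + 1)) * W"
      using weight[of "2 * c + 1"] c by simp
    also have "\<dots> \<le> C" unfolding C_def using W_pos by (intro mult_right_mono) auto
    finally show "(\<Sum>i\<in>?I c. delta d i (x (2 * c))) \<le> C" .
  qed
  have "feasible_on (\<Union>c\<in>set [0..<b]. ?I c) d C (concat (map ?f [0..<b]))"
    using single by (intro feasible_on_concat) auto
  moreover have "(\<Union>c\<in>set [0..<b]. ?I c) = {1..n}"
  proof -
    have "p i div 2 < b" if "i \<in> {1..n}" for i using p[OF that] by linarith
    then show ?thesis by auto
  qed
  ultimately have "feasible_solution n d C (concat (map ?f [0..<b]))"
    by (simp add: feasible_solution_iff)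
  then have "min_bins n d C \<le> length (concat (map ?f [0..<b]))" by (rule min_bins_le)
  then show ?thesis by (simp add: length_concat o_def sum_list_triv)
qed

section \<open>Costs of sets of times and the positions they hit\<close>

text \<open>Competitor: times at the first \<open>k\<close> positions. Even serving every other
  position from \<open>x 0\<close> costs no more than its weight.\<close>

lemma ET_cost_le:
  assumes "1 \<le> k" "ET_optimal n d C k V"
  shows "(\<Sum>i\<in>{1..n}. delta_set d i V) \<le> (\<Sum>j\<in>{k..<2*b}. real q - real j) * W"
proof -
  \<comment> \<open>The minimum covers \<open>k \<ge> 2 * b\<close>, where all positions are taken
    and the claimed bound is 0.\<close>
  let ?W = "x ` {..<min k (2 * b)}"
  have near: "\<exists>\<tau>\<in>?W. \<bar>x j - \<tau>\<bar> \<le> (if j < k then 0 else x j)" if j: "j < 2 * b" for j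
  proof (cases "j < k")
    case True
    then show ?thesis using j by (intro bexI[of _ "x j"]) auto
  next
    case False
    have "x 0 \<in> ?W" using assms(1) b by auto
    moreover have "\<bar>x j - x 0\<bar> \<le> x j" using x_mono[of 0 j] x_pos[of 0] by simp
    ultimately show ?thesis using False by auto
  qed
  have nearC: "\<exists>\<tau>\<in>?W. delta d i \<tau> \<le> C" if i: "i \<in> {1..n}" for i
  proof -
    obtain \<tau> where \<tau>: "\<tau> \<in> ?W" "\<bar>x (p i) - \<tau>\<bar> \<le> (if p i < k then 0 else x (p i))"
      using near[OF p[OF i]] by blast
    have "(if p i < k then 0 else x (p i)) \<le> C"
      using x_le_W[OF p[OF i]] W_le_C C_pos by auto
    then show ?thesis using \<tau> by (intro bexI[of _ \<tau>]) (auto simp: delta_d)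
  qed
  obtain V' where V': "?W \<subseteq> V'" "ET_feasible n d C k V'"
  proof (rule extend_to_ET_feasible[of ?W k n d C])
    show "card ?W \<le> k" using card_image_le[of "{..<min k (2 * b)}" x] by simp
    show "\<forall>\<tau>\<in>?W. 0 \<le> \<tau>" using x_pos less_imp_le by auto
  qed (use nearC in auto)
  have "(\<Sum>i\<in>{1..n}. delta_set d i V) \<le> (\<Sum>i\<in>{1..n}. delta_set d i V')"
    using ET_optimalD(2)[OF assms(2) V'(2)] .
  also have "\<dots> \<le> (\<Sum>i\<in>{1..n}. (\<lambda>j. if j < k then 0 else x j) (p i))"
  proof (rule sum_mono)
    fix i assume i: "i \<in> {1..n}"
    obtain \<tau> where \<tau>: "\<tau> \<in> ?W" "\<bar>x (p i) - \<tau>\<bar> \<le> (if p i < k then 0 else x (p i))"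
      using near[OF p[OF i]] by blast
    have "delta_set d i V' \<le> delta d i \<tau>"
      using V' \<tau>(1) by (intro delta_set_le) (auto simp: ET_feasible_def)
    then show "delta_set d i V' \<le> (\<lambda>j. if j < k then 0 else x j) (p i)"
      using \<tau>(2) by (simp only: delta_d)
  qed
  also have "\<dots> = (\<Sum>j<2*b. real (card {i\<in>{1..n}. p i = j}) * (if j < k then 0 else x j))"
    by (rule sum_items)
  also have "\<dots> = (\<Sum>j<2*b. if j < k then 0 else (real q - real j) * W)"
    using weight by (intro sum.cong) auto
  also have "\<dots> = (\<Sum>j\<in>{k..<2*b}. (real q - real j) * W)"
    by (rule sum.mono_neutral_cong_right) auto
  finally show ?thesis by (simp add: sum_distrib_right)
qed

text \<open>A time hits position \<open>j\<close> if it makes the items there noticeably cheaper than serving them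
  from an earlier position would.\<close>

definition hit :: "nat \<Rightarrow> real \<Rightarrow> bool" where
  "hit j \<tau> \<longleftrightarrow> \<bar>x j - \<tau>\<bar> < (1 - 2 / real R) * x j"

text \<open>Hits of \<open>j\<close> lie strictly between \<open>2 * x j / R\<close> and
  \<open>2 * x j\<close>. As positions grow by the factor \<open>R\<close>, these intervals are
  disjoint and ordered; the constant \<open>2 / R\<close> is chosen for this.\<close>

lemma hit_bounds:
  assumes "hit j \<tau>"
  shows "\<tau> < 2 * x j" "2 * x j < real R * \<tau>" "0 < \<tau>"
proof -
  have R0: "0 < real R" using R_ge by simp
  have 1: "x j - \<tau> < x j - 2 / real R * x j" "\<tau> - x j < x j - 2 / real R * x j"
    using assms by (auto simp: hit_def algebra_simps abs_less_iff)
  have "0 < 2 / real R * x j" using R0 x_pos by simp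
  then show "\<tau> < 2 * x j" "0 < \<tau>" using 1 by linarith+
  have "2 / real R * x j < \<tau>" using 1(1) by simp
  then show "2 * x j < real R * \<tau>" using R0 by (simp add: field_simps)
qed

lemma hit_less:
  assumes "hit i \<sigma>" "hit j \<tau>" "i < j"
  shows "\<sigma> < \<tau>"
proof -
  have "real R * (2 * x i) \<le> 2 * x j" using x_step[OF assms(3)] by simp
  also have "\<dots> < real R * \<tau>" using hit_bounds(2)[OF assms(2)] .
  finally have "2 * x i < \<tau>" using R_ge by simp
  then show ?thesis using hit_bounds(1)[OF assms(1)] by linarith
qed

lemma hit_unique: "\<lbrakk>hit i \<tau>; hit j \<tau>\<rbrakk> \<Longrightarrow> i = j"
  using hit_less[of i \<tau> j \<tau>] hit_less[of j \<tau> i \<tau>] by (cases i j rule: linorder_cases) auto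

lemma missed_cost:
  assumes "finite V" "V \<noteq> {}" "\<forall>\<tau>\<in>V. \<not> hit (p i) \<tau>"
  shows "(1 - 2 / real R) * x (p i) \<le> delta_set d i V"
proof -
  obtain \<tau> where "\<tau> \<in> V" "delta d i \<tau> = delta_set d i V"
    using delta_set_attained[OF assms(1,2)] by blast
  then show ?thesis using assms(3) by (auto simp: hit_def delta_d)
qed

text \<open>Unhit positions save at most the fraction \<open>2 / R\<close> of their weight. This
  serves both to identify the hit positions and to bound the load of the last time from
  below.\<close>

lemma missed_cost_sum:
  assumes "finite V" "V \<noteq> {}" "J \<subseteq> {..<2 * b}" "\<forall>j\<in>J. \<forall>\<tau>\<in>V. \<not> hit j \<tau>"
  shows "(1 - 2 / real R) * W * (\<Sum>j\<in>J. real q - real j) \<le>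
    (\<Sum>i\<in>{i\<in>{1..n}. p i \<in> J}. delta_set d i V)"
proof -
  have fJ: "finite J" using assms(3) finite_subset by blast
  have "(1 - 2 / real R) * W * (\<Sum>j\<in>J. real q - real j) =
      (\<Sum>j\<in>J. (1 - 2 / real R) * ((real q - real j) * W))"
    by (simp add: sum_distrib_left ac_simps)
  also have "\<dots> = (\<Sum>j\<in>J. \<Sum>i\<in>{i\<in>{i\<in>{1..n}. p i \<in> J}. p i = j}. (1 - 2 / real R) * x (p i))"
  proof (rule sum.cong)
    fix j assume j: "j \<in> J"
    have "(\<Sum>i\<in>{i\<in>{i\<in>{1..n}. p i \<in> J}. p i = j}. (1 - 2 / real R) * x (p i)) =
        (\<Sum>i\<in>{i\<in>{1..n}. p i = j}. (1 - 2 / real R) * x j)"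
      using j by (intro sum.cong) auto
    also have "\<dots> = (1 - 2 / real R) * (real (card {i\<in>{1..n}. p i = j}) * x j)" by simp
    also have "\<dots> = (1 - 2 / real R) * ((real q - real j) * W)"
      using weight[of j] j assms(3) by auto
    finally show "(1 - 2 / real R) * ((real q - real j) * W) =
        (\<Sum>i\<in>{i\<in>{i\<in>{1..n}. p i \<in> J}. p i = j}. (1 - 2 / real R) * x (p i))" by (rule sym)
  qed simp
  also have "\<dots> = (\<Sum>i\<in>{i\<in>{1..n}. p i \<in> J}. (1 - 2 / real R) * x (p i))"
    using fJ by (intro sum.group) auto
  also have "\<dots> \<le> (\<Sum>i\<in>{i\<in>{1..n}. p i \<in> J}. delta_set d i V)"
    using assms by (intro sum_mono missed_cost) auto
  finally show ?thesis .
qed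

text \<open>The lowest positions carry slightly more weight than the others, and \<open>R\<close> is so large that no
  saving at the unhit positions can make up for this.\<close>

lemma optimal_hits:
  assumes k: "1 \<le> k" "k \<le> 2 * b" and opt: "ET_optimal n d C k V"
  shows "{j. j < 2 * b \<and> (\<exists>\<tau>\<in>V. hit j \<tau>)} = {..<k}"
proof (rule ccontr)
  let ?H = "{j. j < 2 * b \<and> (\<exists>\<tau>\<in>V. hit j \<tau>)}"
  assume ne: "?H \<noteq> {..<k}"
  have V: "finite V" "card V = k" using ET_optimalD(1)[OF opt] by (auto simp: ET_feasible_def)
  then have Vne: "V \<noteq> {}" using k by auto
  have "\<forall>j\<in>?H. \<exists>\<tau>. \<tau> \<in> V \<and> hit j \<tau>" by blast
  \<comment> \<open>A time hits at most one position, so the choice \<open>f\<close> is injective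
    and at most \<open>k\<close> positions are hit.\<close>
  from bchoice[OF this] obtain f where f: "\<forall>j\<in>?H. f j \<in> V \<and> hit j (f j)" by blast
  have "inj_on f ?H"
  proof (rule inj_onI)
    fix i j assume "i \<in> ?H" "j \<in> ?H" "f i = f j"
    then show "i = j" using f hit_unique[of i "f i" j] by metis
  qed
  moreover have "f ` ?H \<subseteq> V" using f by blast
  ultimately have "card ?H \<le> k" using card_inj_on_le[of f ?H V] V by simp
  then have gap: "(\<Sum>j\<in>?H. real q - real j) + 1 \<le> (\<Sum>j<k. real q - real j)"
    using ne k q_ge by (intro sum_initial_segment_gap[where m = "2 * b"]) auto
  let ?S = "\<Sum>j\<in>{k..<2*b}. real q - real j"
  let ?J = "{..<2 * b} - ?H"
  have "(\<Sum>j\<in>?J. real q - real j) = (\<Sum>j<2*b. real q - real j) - (\<Sum>j\<in>?H. real q - real j)"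
    by (intro sum_diff) auto
  moreover have "(\<Sum>j<2*b. real q - real j) = (\<Sum>j<k. real q - real j) + ?S"
    using k(2) by (simp add: lessThan_atLeast0 sum.atLeastLessThan_concat)
  ultimately have J: "?S + 1 \<le> (\<Sum>j\<in>?J. real q - real j)" using gap by linarith
  have R2: "0 \<le> 1 - 2 / real R" using R_ge by (simp add: field_simps)
  have "(1 - 2 / real R) * W * (?S + 1) \<le> (1 - 2 / real R) * W * (\<Sum>j\<in>?J. real q - real j)"
    using J R2 W_pos by (intro mult_left_mono) auto
  also have "\<dots> \<le> (\<Sum>i\<in>{i\<in>{1..n}. p i \<in> ?J}. delta_set d i V)"
    using V Vne by (intro missed_cost_sum) auto
  also have "\<dots> \<le> (\<Sum>i\<in>{1..n}. delta_set d i V)"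
  proof (rule sum_mono2)
    fix i
    obtain \<tau> where "delta d i \<tau> = delta_set d i V" using delta_set_attained V Vne by metis
    then show "0 \<le> delta_set d i V" using delta_nonneg by metis
  qed auto
  also have "\<dots> \<le> ?S * W" by (rule ET_cost_le[OF k(1) opt])
  finally have "W * ((1 - 2 / real R) * (?S + 1)) \<le> W * ?S" by (simp add: ac_simps)
  then have "(1 - 2 / real R) * (?S + 1) \<le> ?S" using W_pos by (simp only: mult_le_cancel_left_pos)
  then have "1 \<le> 2 / real R * (?S + 1)" by (simp add: algebra_simps)
  \<comment> \<open>With \<open>z = b * q \<ge> 1\<close> and \<open>?S \<le> 2 * z\<close> the
    right-hand side is at most \<open>6 * z\<close>, but \<open>R\<close> is at least
    \<open>8 * z\<close>.\<close>
  then have "real R \<le> 2 * (?S + 1)" using R_ge by (simp add: field_simps)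
  moreover define z where "z = real b * real q"
  moreover have "?S \<le> 2 * z"
  proof -
    have "?S \<le> (\<Sum>j\<in>{k..<2*b}. real q)" by (intro sum_mono) auto
    also have "\<dots> \<le> 2 * (real b * real q)"
      using k by (simp add: mult_right_mono flip: mult.assoc)
    finally show ?thesis by (simp only: z_def)
  qed
  moreover have "1 \<le> z"
    unfolding z_def using b q_ge mult_mono[of 1 "real b" 1 "real q"] by simp
  moreover have "8 * z \<le> real R" using R_ge(1) by (simp only: mult.assoc z_def)
  ultimately show False by simp
qed

section \<open>Every run on the staircase uses many bins\<close>

text \<open>For \<open>k < 2 * b\<close> the last time needs \<open>2 * b - k\<close> bins for the
  positions from \<open>k\<close> on, and each of the other \<open>k - 1\<close> times needs at
  least one, in total \<open>2 * b - 1\<close>. For larger \<open>k\<close> every position has a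
  time of its own.\<close>

lemma decouple_and_refine_ge:
  assumes k: "1 \<le> k" and run: "decouple_and_refine rule n d C k sol"
  shows "2 * b - 1 \<le> length sol"
  using run
proof (rule decouple_and_refineE)
  fix V a bins
  assume opt: "ET_optimal n d C k V"
    and V: "finite V" "card V = k" "\<And>\<tau>. \<tau> \<in> V \<Longrightarrow> 0 \<le> \<tau>"
    and aV: "\<And>i. i \<in> {1..n} \<Longrightarrow> a i \<in> V"
    and aD: "\<And>i. i \<in> {1..n} \<Longrightarrow> delta d i (a i) = delta_set d i V"
    and aC: "\<And>i. i \<in> {1..n} \<Longrightarrow> delta d i (a i) \<le> C"
    and bins: "\<And>\<tau>. \<tau> \<in> V \<Longrightarrow> bins_at rule d C \<tau> {i\<in>{1..n}. a i = \<tau>} (bins \<tau>)"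
    and len: "length sol = (\<Sum>\<tau>\<in>V. length (bins \<tau>))"
  have best: "delta d i (a i) \<le> delta d i \<tau>" if "i \<in> {1..n}" "\<tau> \<in> V" for i \<tau>
    using delta_set_le[OF V(1) that(2), of d i] aD[OF that(1)] by simp
  have "\<forall>j\<in>{..<2*b}. \<exists>i. i \<in> {1..n} \<and> p i = j" using item_exists by blast
  from bchoice[OF this] obtain r where r: "\<And>j. j < 2 * b \<Longrightarrow> r j \<in> {1..n} \<and> p (r j) = j" by blast
  have used: "1 \<le> length (bins (a (r j)))" if "j < 2 * b" for j
  proof -
    have rj: "r j \<in> {1..n}" using r[OF that] by blast
    have "0 < length (bins (a (r j)))"
    proof (rule bins_at_nonempty[OF bins])
      show "delta d i (a (r j)) \<le> C" if "i \<in> {i\<in>{1..n}. a i = a (r j)}" for i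
        using that aC[of i] by simp
    qed (use rj aV V(3) C_pos in auto)
    then show ?thesis by (simp only: Suc_le_eq One_nat_def)
  qed
  show "2 * b - 1 \<le> length sol"
  proof (cases "k < 2 * b")
    case False
    have "{k..<2*b} = {}" using False by simp
    then have "(\<Sum>i\<in>{1..n}. delta d i (a i)) \<le> 0"
      using ET_cost_le[OF k opt] aD by simp
    then have zero: "delta d i (a i) = 0" if "i \<in> {1..n}" for i
      using that sum_nonneg_0[of "{1..n}" "\<lambda>i. delta d i (a i)" i]
        sum_nonneg[of "{1..n}" "\<lambda>i. delta d i (a i)"] by (simp add: delta_nonneg)
    have ar: "a (r j) = x j" if "j < 2 * b" for j
      using zero[of "r j"] r[OF that] by (simp add: delta_d)
    have inj: "inj_on (\<lambda>j. a (r j)) {..<2*b}"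
    proof (rule inj_onI)
      fix i j assume ij: "i \<in> {..<2*b}" "j \<in> {..<2*b}" "a (r i) = a (r j)"
      then have "real R ^ i = real R ^ j" using ar by (simp add: x_def)
      then show "i = j" using R_ge by (intro power_inject_exp[THEN iffD1]) auto
    qed
    have "2 * b = (\<Sum>j<2*b. 1)" by simp
    also have "\<dots> \<le> (\<Sum>j<2*b. length (bins (a (r j))))" using used by (intro sum_mono) auto
    also have "\<dots> = (\<Sum>\<tau>\<in>(\<lambda>j. a (r j)) ` {..<2*b}. length (bins \<tau>))"
      using sum.reindex[OF inj, of "\<lambda>\<tau>. length (bins \<tau>)"] by (simp add: o_def)
    also have "\<dots> \<le> length sol"
      unfolding len using V(1) aV r by (intro sum_mono2) auto
    finally show ?thesis by simp
  next
    case True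
    note H = optimal_hits[OF k less_imp_le[OF True] opt]
    \<comment> \<open>The assigned time is at least as close as the hitting one, so it is itself a
      hit.\<close>
    have hit_a: "hit (p i) (a i)" if i: "i \<in> {1..n}" "p i < k" for i
    proof -
      have "p i \<in> {..<k}" using i(2) by simp
      then obtain \<tau> where \<tau>: "\<tau> \<in> V" "hit (p i) \<tau>" unfolding H[symmetric] by blast
      show ?thesis using best[OF i(1) \<tau>(1)] \<tau>(2) unfolding hit_def delta_d by linarith
    qed
    have hit_r: "hit j (a (r j))" if "j < k" for j
    proof -
      have j: "r j \<in> {1..n}" "p (r j) = j" using r[of j] that True by linarith+
      then show ?thesis using hit_a[OF j(1)] that by simp
    qed
    have inj: "inj_on (\<lambda>j. a (r j)) {..<k}"
    proof (rule inj_onI)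
      fix i j assume "i \<in> {..<k}" "j \<in> {..<k}" and eq: "a (r i) = a (r j)"
      then have "hit i (a (r i))" "hit j (a (r j))" using hit_r by blast+
      then show "i = j" unfolding eq by (rule hit_unique)
    qed
    have "(\<lambda>j. a (r j)) ` {..<k} \<subseteq> V" using aV r True by auto
    \<comment> \<open>The \<open>k\<close> lowest positions are hit by \<open>k\<close> different
      times, which exhausts \<open>V\<close>.\<close>
    then have Vr: "V = (\<lambda>j. a (r j)) ` {..<k}"
      using V(1,2) card_image[OF inj] by (intro card_subset_eq[symmetric]) auto
    define t where "t = a (r (k - 1))"
    have tV: "t \<in> V" using Vr k by (auto simp: t_def)
    have hit_t: "hit (k - 1) t" using hit_r[of "k - 1"] k by (simp add: t_def)
    \<comment> \<open>Every other time lies to the left of \<open>t\<close>, and \<open>t\<close>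
      lies to the left of position \<open>p i\<close>, so \<open>t\<close> is strictly
      closer.\<close>
    have far: "a i = t" if i: "i \<in> {1..n}" "k \<le> p i" for i
    proof (rule ccontr)
      assume nt: "a i \<noteq> t"
      obtain j where j: "j < k" "a i = a (r j)" using aV[OF i(1)] Vr by auto
      then have "j \<noteq> k - 1" using nt by (auto simp: t_def)
      then have "j < k - 1" using j(1) by linarith
      then have "a i < t" using hit_less[OF hit_r[OF j(1)] hit_t] j(2) by simp
      moreover have "t < x (p i)"
      proof -
        have "t < 2 * x (k - 1)" using hit_bounds(1)[OF hit_t] .
        also have "\<dots> \<le> real R * x (k - 1)" using R_ge x_pos by (intro mult_right_mono) (auto intro: less_imp_le)
        also have "\<dots> \<le> x (p i)" using i k by (intro x_step) simp
        finally show ?thesis .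
      qed
      ultimately show False using best[OF i(1) tV] unfolding delta_d by linarith
    qed
    \<comment> \<open>A time hitting position 0 lies between 0 and \<open>2 * x 0\<close>, hence
      within \<open>x (p i)\<close> of every item. The resulting bound \<open>W\<close> is the
      \<open>\<sigma>\<close> used when the bins at \<open>t\<close> are counted.\<close>
    have small: "delta d i (a i) \<le> W" if i: "i \<in> {1..n}" for i
    proof -
      have r0: "hit 0 (a (r 0))" using hit_r k by simp
      have "a (r 0) \<in> V" using Vr k by auto
      then have "delta d i (a i) \<le> delta d i (a (r 0))" using best[OF i] by simp
      also have "\<dots> \<le> x (p i)"
        using hit_bounds[OF r0] x_mono[of 0 "p i"] by (simp add: delta_d)
      also have "\<dots> \<le> W" using x_le_W p[OF i] .
      finally show ?thesis .
    qed
    let ?S = "\<Sum>j\<in>{k..<2*b}. real q - real j"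
    have R2: "0 \<le> 1 - 2 / real R" using R_ge by (simp add: field_simps)
    \<comment> \<open>Each summand loses \<open>j \<le> 2 * b - 1\<close> through the decreasing
      weights and at most 1 through the factor \<open>1 - 2 / R\<close>.\<close>
    have "real (2 * b - k) * (real q - 2 * real b) = (\<Sum>j\<in>{k..<2*b}. real q - 2 * real b)"
      by simp
    also have "\<dots> \<le> (\<Sum>j\<in>{k..<2*b}. (1 - 2 / real R) * (real q - real j))"
    proof (rule sum_mono)
      fix j assume j: "j \<in> {k..<2*b}"
      have "real q \<le> real b * real q" using b mult_right_mono[of 1 "real b" "real q"] by simp
      have "2 * (real q - real j) \<le> 8 * real q" by simp
      also have "\<dots> \<le> 8 * (real b * real q)" using \<open>real q \<le> real b * real q\<close> by simp
      also have "\<dots> \<le> real R" using R_ge(1) by (simp only: mult.assoc)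
      finally have "2 * (real q - real j) \<le> real R" .
      then have "2 / real R * (real q - real j) \<le> 1" using R_ge(2) by (simp add: field_simps)
      moreover have "real j + 1 \<le> 2 * real b" using j by auto
      ultimately show "real q - 2 * real b \<le> (1 - 2 / real R) * (real q - real j)"
        by (simp add: left_diff_distrib)
    qed
    finally have low: "real (2 * b - k) * (real q - 2 * real b) \<le> (1 - 2 / real R) * ?S"
      by (simp add: sum_distrib_left)
    have "W * (real (2 * b - k) * (real q - 2 * real b)) \<le> W * ((1 - 2 / real R) * ?S)"
      using low W_pos by simp
    also have "\<dots> = (1 - 2 / real R) * W * ?S" by simp
    also have "\<dots> \<le> (\<Sum>i\<in>{i\<in>{1..n}. p i \<in> {k..<2*b}}. delta_set d i V)"
    proof (rule missed_cost_sum)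
      show "\<forall>j\<in>{k..<2*b}. \<forall>\<tau>\<in>V. \<not> hit j \<tau>"
      proof (intro ballI notI)
        fix j \<tau> assume j: "j \<in> {k..<2*b}" and "\<tau> \<in> V" "hit j \<tau>"
        then have "j \<in> {j. j < 2 * b \<and> (\<exists>\<tau>\<in>V. hit j \<tau>)}" by auto
        then show False using j unfolding H by simp
      qed
      show "V \<noteq> {}" using tV by blast
    qed (use V(1) in auto)
    also have "\<dots> = (\<Sum>i\<in>{i\<in>{1..n}. p i \<in> {k..<2*b}}. delta d i t)"
    proof (rule sum.cong)
      fix i assume i: "i \<in> {i\<in>{1..n}. p i \<in> {k..<2*b}}"
      then have "a i = t" by (intro far) simp_all
      then show "delta_set d i V = delta d i t" using aD[of i] i by simp
    qed (rule refl)
    also have "\<dots> \<le> (\<Sum>i\<in>{i\<in>{1..n}. a i = t}. delta d i t)"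
    proof (rule sum_mono2)
      show "{i\<in>{1..n}. p i \<in> {k..<2*b}} \<subseteq> {i\<in>{1..n}. a i = t}"
      proof
        fix i assume i: "i \<in> {i\<in>{1..n}. p i \<in> {k..<2*b}}"
        then have "a i = t" by (intro far) simp_all
        then show "i \<in> {i\<in>{1..n}. a i = t}" using i by simp
      qed
    qed (simp_all add: delta_nonneg)
    also have "\<dots> \<le> real (length (bins t)) * (C + W)"
    proof (rule bins_at_length_ge[OF bins[OF tV]])
      show "delta d i t \<le> W" if "i \<in> {i\<in>{1..n}. a i = t}" for i
        using that small[of i] by simp
    qed (use W_pos W_le_C C_pos in simp_all)
    also have "\<dots> = W * (real (length (bins t)) * (real q + 1))" by (simp add: C_def algebra_simps)
    finally have N: "real (2 * b - k) * (real q - 2 * real b) \<le> real (length (bins t)) * (real q + 1)"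
      using W_pos by (simp only: mult_le_cancel_left_pos)
    \<comment> \<open>One bin less would give \<open>q + 1 \<le> (2 * b - k) * (2 * b + 1) \<le> 2 *
      b * (2 * b + 1) = q\<close>; this is the origin of \<open>q\<close>.\<close>
    have "2 * b - k \<le> length (bins t)"
    proof (rule ccontr)
      assume "\<not> 2 * b - k \<le> length (bins t)"
      then have "real (length (bins t)) \<le> real (2 * b - k) - 1" by linarith
      then have "real (length (bins t)) * (real q + 1) \<le> (real (2 * b - k) - 1) * (real q + 1)"
        by (intro mult_right_mono) auto
      from order_trans[OF N this] have "real q + 1 \<le> real (2 * b - k) * (2 * real b + 1)"
        by (simp add: algebra_simps del: of_nat_diff)
      also have "\<dots> \<le> (2 * real b) * (2 * real b + 1)" by (intro mult_right_mono) auto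
      also have "\<dots> = real q" by (simp add: q algebra_simps)
      finally show False by simp
    qed
    \<comment> \<open>Every other time is some \<open>a (r j)\<close> and so has at least the item
      \<open>r j\<close> to deliver.\<close>
    moreover have "k - 1 \<le> (\<Sum>\<tau>\<in>V - {t}. length (bins \<tau>))"
    proof -
      have "k - 1 = (\<Sum>\<tau>\<in>V - {t}. 1)" using V tV by simp
      also have "\<dots> \<le> (\<Sum>\<tau>\<in>V - {t}. length (bins \<tau>))"
      proof (rule sum_mono)
        fix \<tau> assume "\<tau> \<in> V - {t}"
        then obtain j where "j < k" "\<tau> = a (r j)" using Vr by blast
        then show "1 \<le> length (bins \<tau>)" using used[of j] True by simp
      qed
      finally show ?thesis .
    qed
    moreover have "length sol = length (bins t) + (\<Sum>\<tau>\<in>V - {t}. length (bins \<tau>))"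
      unfolding len using V(1) tV by (rule sum.remove)
    ultimately show ?thesis using k True by linarith
  qed
qed

lemma refined_decoupling_ge:
  assumes "refined_decoupling rule n d C sol"
  shows "2 * b - 1 \<le> length sol"
  using assms decouple_and_refine_ge by (elim refined_decouplingE) auto

end

lemma staircase_exists:
  assumes "1 \<le> b"
  shows "\<exists>q R n p. staircase b q R n p"
proof -
  define q where "q = 4 * b * b + 2 * b"
  define R where "R = 8 * b * q"
  define M where "M = (\<lambda>j. (q - j) * R ^ (2 * b - 1 - j))"
  \<comment> \<open>The items are pairs of a position and a copy number, renumbered by
    \<open>{1..n}\<close>.\<close>
  define A where "A = (SIGMA j:{..<2*b}. {..<M j})"
  define n where "n = card A"
  have "finite A" by (simp add: A_def)
  then obtain h where h: "bij_betw h {1..n} A"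
    using ex_bij_betw_nat_finite_1 unfolding n_def by blast
  have "card {i\<in>{1..n}. fst (h i) = j} = M j" if j: "j < 2 * b" for j
  proof -
    have "bij_betw h {i\<in>{1..n}. fst (h i) = j} {z\<in>A. fst z = j}"
      using h unfolding bij_betw_def inj_on_def by blast
    then have "card {i\<in>{1..n}. fst (h i) = j} = card {z\<in>A. fst z = j}"
      by (rule bij_betw_same_card)
    also have "{z\<in>A. fst z = j} = {j} \<times> {..<M j}" using j by (auto simp: A_def)
    finally show ?thesis by simp
  qed
  moreover have "fst (h i) < 2 * b" if "i \<in> {1..n}" for i
  proof -
    have "h i \<in> A" using h that by (auto simp: bij_betw_def)
    then show ?thesis by (auto simp: A_def)
  qed
  ultimately have "staircase b q R n (\<lambda>i. fst (h i))"
    using assms unfolding staircase_def M_def by (simp add: q_def R_def)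
  then show ?thesis by blast
qed

theorem theorem17:
  fixes rule :: packing_rule
  shows "(\<forall>n d B. delivery_instance n d B \<longrightarrow>
            (\<exists>sol. refined_decoupling rule n d B sol) \<and>
            (\<forall>sol. refined_decoupling rule n d B sol \<longrightarrow>
               feasible_solution n d B sol \<and> length sol \<le> 2 * min_bins n d B)) \<and>
         (\<forall>c::real. c < 2 \<longrightarrow>
            (\<exists>n d B. delivery_instance n d B \<and>
               (\<forall>sol. refined_decoupling rule n d B sol \<longrightarrow>
                  real (length sol) > c * real (min_bins n d B))))"
proof (intro conjI allI impI)
  fix n d and B :: real and sol
  assume inst: "delivery_instance n d B"
  then show "\<exists>sol. refined_decoupling rule n d B sol" by (rule refined_decoupling_exists)
  assume run: "refined_decoupling rule n d B sol"
  obtain k where "decouple_and_refine rule n d B k sol"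
    using refined_decouplingE[OF run] by blast
  then show "feasible_solution n d B sol"
    using inst decouple_and_refine_feasible by (simp add: delivery_instance_def)
  show "length sol \<le> 2 * min_bins n d B" using inst run by (rule refined_decoupling_two_approx)
next
  fix c :: real
  assume c: "c < 2"
  \<comment> \<open>This choice amounts to \<open>c * b0 < 2 * b0 - 1\<close>.\<close>
  obtain b0 :: nat where "1 / (2 - c) < real b0" using reals_Archimedean2 by blast
  then have b0: "1 < real b0 * (2 - c)" using c by (simp add: field_simps)
  then have b1: "1 \<le> b0" by (cases b0) auto
  obtain q R n p where "staircase b0 q R n p" using staircase_exists[OF b1] by blast
  then interpret staircase b0 q R n p .
  have "c * real (min_bins n d C) < real (length sol)" if "refined_decoupling rule n d C sol" for sol
  proof -
    have "2 * b0 - 1 \<le> length sol" using that by (rule refined_decoupling_ge)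
    then have sol: "2 * real b0 - 1 \<le> real (length sol)" using b1 by linarith
    show ?thesis
    proof (cases "0 \<le> c")
      case True
      then have "c * real (min_bins n d C) \<le> c * real b0"
        using min_bins_le_b by (intro mult_left_mono) auto
      then show ?thesis using b0 sol by (simp add: algebra_simps)
    next
      \<comment> \<open>For negative \<open>c\<close> the bound
        \<open>min_bins n d C \<le> b0\<close> points the wrong way, but the product is at most 0
        and the solution has a bin.\<close>
      case False
      then have "c * real (min_bins n d C) \<le> 0" by (simp add: mult_nonpos_nonneg)
      then show ?thesis using sol b1 by linarith
    qed
  qed
  then show "\<exists>n d B. delivery_instance n d B \<and>
      (\<forall>sol. refined_decoupling rule n d B sol \<longrightarrow> c * real (min_bins n d B) < real (length sol))"
    using valid_instance by blast
qed

end
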